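(* Let $d\ge 2$. There exist positive constants $a_1,a_2,a_3$ depending only on $d$ such that the following holds. Let $S$ be a $2$-colored set of $n$ points in general position in $\mathbb{R}^d$, partitioned into a red point set $R$ and a blue point set $B$. Then either there exist at least $a_1 n^{d-2/3}$ empty red $d$-simplices, or there exists a convex set $C\subseteq\mathbb{R}^d$ such that $|S\cap C|\ge a_2 n$ and $\delta(S\cap C)=\big||C\cap R|-|C\cap B|\big|\ge a_3\sqrt[3]{n}$. (In the paper's notation: $\Omega(n^{d-2/3})$ empty red $d$-simplices, or $|S\cap C|=\Theta(n)$ and $\delta(S\cap C)=\Omega(\sqrt[3]{n})$.)
   Context: General position: every subset of at most $d+1$ points is affinely independent. A $d$-simplex $\mathrm{Conv}(S')$ with $S'\subseteq S$, $|S'|=d+1$, is empty if $\mathrm{Conv}(S')\cap S=S'$, and red if $S'\subseteq R$. For a two-colored set the discrepancy is the absolute difference of the sizes of the two color classes. *)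

theory Defs
  imports "HOL-Analysis.Analysis"
begin

definition general_position :: "(real ^ 'n) set \<Rightarrow> bool" where
  "general_position S \<longleftrightarrow>
     (\<forall>T. T \<subseteq> S \<and> finite T \<and> card T \<le> CARD('n) + 1 \<longrightarrow> \<not> affine_dependent T)"

text \<open>The vertex set \<open>T\<close> spans an empty full-dimensional simplex of the point set \<open>S\<close>;
  affine independence of \<open>T\<close> comes from general position of \<open>S\<close>.\<close>

definition spans_empty_simplex :: "(real ^ 'n) set \<Rightarrow> (real ^ 'n) set \<Rightarrow> bool" where
  "spans_empty_simplex S T \<longleftrightarrow>
     T \<subseteq> S \<and> card T = CARD('n) + 1 \<and> convex hull T \<inter> S = T"

definition empty_red_simplices ::
    "(real ^ 'n) set \<Rightarrow> (real ^ 'n) set \<Rightarrow> (real ^ 'n) set set" where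
  "empty_red_simplices S R = {convex hull T | T. spans_empty_simplex S T \<and> T \<subseteq> R}"

definition discrepancy :: "'a set \<Rightarrow> 'a set \<Rightarrow> real" where
  "discrepancy R B = \<bar>real (card R) - real (card B)\<bar>"

end

theory Submission
  imports Defs
begin

text \<open>
  Fix \<open>d - 2\<close> red points \<open>X\<close> and a hyperplane through \<open>X\<close>. Central projection from \<open>X\<close> maps the
  richer open side to a plane, where empty red triangles lift to empty red simplices containing \<open>X\<close>
  and convex sets pull back to convex sets. It therefore suffices to find, for every \<open>X\<close>, about
  \<open>n\<^bsup>4/3\<^esup>\<close> empty red triangles in the plane, and to count pairs.

  In the plane let \<open>\<delta>\<close> be a small multiple of \<open>n\<^bsup>1/3\<^esup>\<close>. If linearly many red points lie in at
  least \<open>\<delta>\<close> empty red triangles, we are done. Otherwise let \<open>C\<close> be the hull of the remaining red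
  points. Deleting the vertices of \<open>C\<close> leaves a convex set, so small discrepancy leaves fewer than
  \<open>2\<delta>\<close> vertices, and the fan from a vertex \<open>p\<close> has a triangle \<open>pxy\<close> with \<open>m\<close>, of order \<open>\<delta>\<^sup>2\<close>,
  red points inside. Splitting it along a chain of \<open>\<surd>m\<close> red points nested over \<open>px\<close> or over
  \<open>py\<close> produces \<open>m + \<surd>m + 1\<close> red triangles with disjoint interiors and no red points inside, each
  having a vertex among \<open>p, x, y\<close>. The blue points inside number at most \<open>m + O(\<delta>)\<close>, hence one of
  \<open>p, x, y\<close> lies in more than \<open>\<delta>\<close> empty red triangles, a contradiction.
\<close>

section \<open>Orientation in the plane\<close>

type_synonym point = "real \<times> real"

definition orient :: "point \<Rightarrow> point \<Rightarrow> point \<Rightarrow> real" where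
  "orient a b c = (fst b - fst a) * (snd c - snd a) - (snd b - snd a) * (fst c - fst a)"

lemma orient_rotate: "orient a b c = orient b c a"
  by (simp add: orient_def algebra_simps)

lemma orient_swap: "orient a c b = - orient a b c"
  by (simp add: orient_def algebra_simps)

lemma orient_degenerate [simp]:
  "orient a a b = 0" "orient a b a = 0" "orient b a a = 0"
  by (simp_all add: orient_def)

lemma orient_affine:
  assumes "u + v + w = 1"
  shows "orient a b (u *\<^sub>R x + v *\<^sub>R y + w *\<^sub>R z) = u * orient a b x + v * orient a b y + w * orient a b z"
proof -
  have u: "u = 1 - v - w" using assms by simp
  show ?thesis unfolding u by (simp add: orient_def algebra_simps)
qed

text \<open>The three-term Grassmann-Pluecker relation. It is what makes the angular order about
  \<open>p\<close> transitive.\<close>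

lemma orient_pluecker:
  "orient p x r * orient p z y = orient p x z * orient p r y + orient p z r * orient p x y"
  by (simp add: orient_def algebra_simps)

lemma convex_orient_nonneg: "convex {z. 0 \<le> orient a b z}"
  unfolding convex_def
proof (intro ballI allI impI)
  fix x y and u v :: real
  assume h: "x \<in> {z. 0 \<le> orient a b z}" "y \<in> {z. 0 \<le> orient a b z}" "0 \<le> u" "0 \<le> v" "u + v = 1"
  have "orient a b (u *\<^sub>R x + v *\<^sub>R y + 0 *\<^sub>R y) = u * orient a b x + v * orient a b y + 0 * orient a b y"
    by (rule orient_affine) (use h in simp)
  then show "u *\<^sub>R x + v *\<^sub>R y \<in> {z. 0 \<le> orient a b z}" using h by simp
qed

lemma in_triangle_orient_nonneg:
  assumes "0 \<le> orient a b c" "z \<in> convex hull {a, b, c}"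
  shows "0 \<le> orient a b z" "0 \<le> orient b c z" "0 \<le> orient c a z"
proof -
  have "convex hull {a,b,c} \<subseteq> {z. 0 \<le> orient a b z}"
    by (rule hull_minimal) (use assms in \<open>auto simp: convex_orient_nonneg\<close>)
  then show "0 \<le> orient a b z" using assms by blast
  have "convex hull {a,b,c} \<subseteq> {z. 0 \<le> orient b c z}"
    by (rule hull_minimal) (use assms in \<open>auto simp: convex_orient_nonneg orient_rotate[of a b c]\<close>)
  then show "0 \<le> orient b c z" using assms by blast
  have "convex hull {a,b,c} \<subseteq> {z. 0 \<le> orient c a z}"
    by (rule hull_minimal) (use assms in \<open>auto simp: convex_orient_nonneg orient_rotate[of c a b]\<close>)
  then show "0 \<le> orient c a z" using assms by blast
qed

text \<open>The barycentric coordinates of \<open>z\<close> are the signed areas of the three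
  triangles that \<open>z\<close> spans with the sides, divided by the area of the whole.\<close>

lemma in_triangle_if_orient_nonneg:
  assumes "0 < orient a b c" "0 \<le> orient a b z" "0 \<le> orient b c z" "0 \<le> orient c a z"
  shows "z \<in> convex hull {a, b, c}"
proof -
  define D where "D = orient a b c"
  have s: "orient b c z + orient c a z + orient a b z = D"
    unfolding D_def by (simp add: orient_def algebra_simps)
  have D: "D > 0" using assms D_def by simp
  have "D *\<^sub>R z = orient b c z *\<^sub>R a + orient c a z *\<^sub>R b + orient a b z *\<^sub>R c"
    unfolding D_def by (cases z; cases a; cases b; cases c) (simp add: orient_def algebra_simps)
  then have "z = (1/D) *\<^sub>R (orient b c z *\<^sub>R a + orient c a z *\<^sub>R b + orient a b z *\<^sub>R c)"
    using D by (metis divide_self_if less_irrefl scaleR_one scaleR_scaleR times_divide_eq_left mult_1)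
  then have "z = (orient b c z / D) *\<^sub>R a + (orient c a z / D) *\<^sub>R b + (orient a b z / D) *\<^sub>R c"
    by (simp add: scaleR_add_right)
  moreover have "orient b c z / D + orient c a z / D + orient a b z / D = 1"
    using s D by (simp flip: add_divide_distrib)
  ultimately show ?thesis
    unfolding convex_hull_3 using assms D by (auto intro!: exI[of _ "_ / D"])
qed

lemma orient_zero_if_between: "z \<in> convex hull {a, b} \<Longrightarrow> orient a b z = 0"
  unfolding convex_hull_2
  apply clarify
  subgoal for u v using orient_affine[of u v 0 a b a b a] by simp
  done

lemma collinear_if_orient_zero:
  assumes "orient a b c = 0" "a \<noteq> b"
  obtains t where "c = a + t *\<^sub>R (b - a)"
proof (cases "fst a = fst b")
  case True
  then have s: "snd b - snd a \<noteq> 0" using assms(2) by (auto simp: prod_eq_iff)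
  with assms True have "fst c = fst a" by (auto simp: orient_def)
  then have "c = a + ((snd c - snd a) / (snd b - snd a)) *\<^sub>R (b - a)"
    using True s by (auto simp: prod_eq_iff)
  then show ?thesis by (rule that)
next
  case False
  define t where "t = (fst c - fst a) / (fst b - fst a)"
  have t: "t * (fst b - fst a) = fst c - fst a" using False by (simp add: t_def)
  have "(fst b - fst a) * (snd c - snd a) = (fst b - fst a) * (t * (snd b - snd a))"
    using assms(1) unfolding orient_def by (metis t eq_iff_diff_eq_0 mult.assoc mult.commute)
  then have "snd c - snd a = t * (snd b - snd a)" using False by simp
  then have "c = a + t *\<^sub>R (b - a)" using t by (simp add: prod_eq_iff)
  then show ?thesis by (rule that)
qed

lemma affine_independent_if_orient_nonzero:
  assumes "orient a b c \<noteq> 0"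
  shows "\<not> affine_dependent {a, b, c}"
proof
  have ne: "a \<noteq> b" "b \<noteq> c" "a \<noteq> c" using assms by auto
  assume "affine_dependent {a, b, c}"
  then obtain U where U: "U a + U b + U c = 0" "U a \<noteq> 0 \<or> U b \<noteq> 0 \<or> U c \<noteq> 0"
    "U a *\<^sub>R a + U b *\<^sub>R b + U c *\<^sub>R c = 0"
    using ne by (subst (asm) affine_dependent_explicit_finite) (auto simp: add.assoc)
  have f: "U a * fst a + U b * fst b + U c * fst c = 0" "U a * snd a + U b * snd b + U c * snd c = 0"
    using U(3) by (auto simp: prod_eq_iff)
  \<comment> \<open>Cramer's rule: eliminating the other two coefficients leaves one coefficient
    times the determinant.\<close>
  have "U c * orient a b c = 0" "U b * orient a b c = 0"
    using f U(1) unfolding orient_def by algebra+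
  then show False using U assms by auto
qed

section \<open>Two-coloured point sets in the plane\<close>

locale two_coloured_plane =
  fixes R B :: "point set"
  assumes finite_R: "finite R" and finite_B: "finite B" and disjoint: "R \<inter> B = {}"
    and orient_nonzero:
      "\<lbrakk>a \<in> R \<union> B; b \<in> R \<union> B; c \<in> R \<union> B; a \<noteq> b; b \<noteq> c; a \<noteq> c\<rbrakk> \<Longrightarrow> orient a b c \<noteq> 0"
begin

section \<open>Sweeping wedges about an apex\<close>

definition empty_triangles :: "point set set" where
  "empty_triangles = {T. T \<subseteq> R \<and> card T = 3 \<and> convex hull T \<inter> (R \<union> B) = T}"

lemma finite_empty_triangles: "finite empty_triangles"
  unfolding empty_triangles_def using finite_R by (auto intro: finite_subset[of _ "Pow R"])

text \<open>Under \<open>0 < orient p x y\<close> this is the open angle at \<open>p\<close> swept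
  counterclockwise from the ray through \<open>x\<close> to the ray through
  \<open>y\<close>.\<close>

definition wedge :: "point \<Rightarrow> point \<Rightarrow> point \<Rightarrow> point set" where
  "wedge p x y = {z. 0 < orient p x z \<and> 0 < orient p z y}"

text \<open>The closed version admits triangles whose vertices are the apex or lie on the bounding
  rays.\<close>

definition closed_wedge :: "point \<Rightarrow> point \<Rightarrow> point \<Rightarrow> point set" where
  "closed_wedge p x y = {z. 0 \<le> orient p x z \<and> 0 \<le> orient p z y}"

definition empties_in_wedge :: "point set \<Rightarrow> point \<Rightarrow> point \<Rightarrow> point \<Rightarrow> point set set" where
  "empties_in_wedge K p x y = {T \<in> empty_triangles. p \<in> T \<and> T \<subseteq> K \<inter> closed_wedge p x y}"

text \<open>Sweeping a ray about \<open>p\<close> through the wedge, \<open>r\<close> red points give \<open>r + 1\<close> triangles with apex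
  \<open>p\<close>, each of which is empty or contains a blue point; the excess measures the slack.\<close>

definition wedge_excess :: "point set \<Rightarrow> point \<Rightarrow> point \<Rightarrow> point \<Rightarrow> int" where
  "wedge_excess K p x y =
     int (card (B \<inter> K \<inter> wedge p x y)) + int (card (empties_in_wedge K p x y))
     - int (card (R \<inter> K \<inter> wedge p x y)) - 1"

lemma finite_empties_in_wedge: "finite (empties_in_wedge K p x y)"
  unfolding empties_in_wedge_def using finite_empty_triangles by simp

text \<open>After multiplication by a positive orientation, a Pluecker relation expresses the
  missing sign as a sum of products of known signs.\<close>

lemma wedge_split_subset:
  assumes r: "r \<in> wedge p x y" and xy: "0 < orient p x y"
  shows "wedge p x r \<subseteq> wedge p x y" "wedge p r y \<subseteq> wedge p x y"
    "closed_wedge p x r \<subseteq> closed_wedge p x y" "closed_wedge p r y \<subseteq> closed_wedge p x y"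
proof -
  have xr: "0 < orient p x r" and ry: "0 < orient p r y" using r by (auto simp: wedge_def)
  show "wedge p x r \<subseteq> wedge p x y"
  proof
    fix z assume z: "z \<in> wedge p x r"
    then have "0 < orient p x r * orient p z y"
      unfolding orient_pluecker[of p x r z y] using xr ry xy by (simp add: wedge_def add_pos_pos)
    then show "z \<in> wedge p x y" using z xr by (simp add: wedge_def zero_less_mult_iff)
  qed
  show "closed_wedge p x r \<subseteq> closed_wedge p x y"
  proof
    fix z assume z: "z \<in> closed_wedge p x r"
    then have "0 \<le> orient p x r * orient p z y"
      unfolding orient_pluecker[of p x r z y] using xr ry xy by (simp add: closed_wedge_def)
    then show "z \<in> closed_wedge p x y" using z xr by (simp add: closed_wedge_def zero_le_mult_iff)
  qed
  have pl: "orient p r y * orient p x z = orient p x y * orient p r z + orient p x r * orient p z y" for z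
    by (simp add: orient_def algebra_simps)
  show "wedge p r y \<subseteq> wedge p x y"
  proof
    fix z assume z: "z \<in> wedge p r y"
    then have "0 < orient p r y * orient p x z"
      unfolding pl using xr ry xy by (simp add: wedge_def add_pos_pos)
    then show "z \<in> wedge p x y" using z ry by (simp add: wedge_def zero_less_mult_iff)
  qed
  show "closed_wedge p r y \<subseteq> closed_wedge p x y"
  proof
    fix z assume z: "z \<in> closed_wedge p r y"
    then have "0 \<le> orient p r y * orient p x z"
      unfolding pl using xr ry xy by (simp add: closed_wedge_def)
    then show "z \<in> closed_wedge p x y" using z ry by (simp add: closed_wedge_def zero_le_mult_iff)
  qed
qed

lemma wedge_split_cover:
  assumes "p \<in> R" "r \<in> R" "p \<noteq> r" "z \<in> wedge p x y" "z \<in> R \<union> B" "z \<noteq> r"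
  shows "z \<in> wedge p x r \<union> wedge p r y"
proof -
  have "p \<noteq> z" using assms by (auto simp: wedge_def)
  then have "orient p r z \<noteq> 0" using orient_nonzero[of p r z] assms by blast
  then show ?thesis using assms orient_swap[of p z r] by (auto simp: wedge_def)
qed

lemma wedge_split_disjoint: "wedge p x r \<inter> wedge p r y = {}"
  using orient_swap[of p _ r] by (fastforce simp: wedge_def)

text \<open>Superadditivity: the blue points and the empty triangles of the two parts are disjoint
  families inside the whole, and the red points of the whole are those of the parts together with
  \<open>r\<close>. The constant 1, subtracted once for each part, pays for
  \<open>r\<close>.\<close>

lemma wedge_excess_split:
  assumes p: "p \<in> R" and r: "r \<in> R" "r \<in> K" "r \<in> wedge p x y" and xy: "0 < orient p x y"
  shows "wedge_excess K p x r + wedge_excess K p r y \<le> wedge_excess K p x y"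
proof -
  have xr: "0 < orient p x r" using r by (auto simp: wedge_def)
  note sub = wedge_split_subset[OF r(3) xy]
  have pr: "p \<noteq> r" using xr by auto
  \<comment> \<open>The two closed parts share only points of the line \<open>pr\<close>, so no
    three red points lie in both and no triangle is counted twice.\<close>
  have cdis: "z = p \<or> z = r" if "z \<in> closed_wedge p x r \<inter> closed_wedge p r y" "z \<in> R" for z
  proof -
    have "orient p r z = 0" using that orient_swap[of p z r] by (auto simp: closed_wedge_def)
    then show ?thesis using orient_nonzero[of p r z] p r that pr by blast
  qed
  have "B \<inter> K \<inter> wedge p x r \<union> B \<inter> K \<inter> wedge p r y \<subseteq> B \<inter> K \<inter> wedge p x y"
    using sub by auto
  then have "card (B \<inter> K \<inter> wedge p x r \<union> B \<inter> K \<inter> wedge p r y) \<le> card (B \<inter> K \<inter> wedge p x y)"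
    by (rule card_mono[rotated]) (use finite_B in simp)
  moreover have "card (B \<inter> K \<inter> wedge p x r \<union> B \<inter> K \<inter> wedge p r y)
      = card (B \<inter> K \<inter> wedge p x r) + card (B \<inter> K \<inter> wedge p r y)"
    by (rule card_Un_disjoint) (use finite_B wedge_split_disjoint[of p x r y] in auto)
  ultimately have b: "card (B \<inter> K \<inter> wedge p x r) + card (B \<inter> K \<inter> wedge p r y) \<le> card (B \<inter> K \<inter> wedge p x y)"
    by simp
  have "empties_in_wedge K p x r \<inter> empties_in_wedge K p r y = {}"
  proof (rule ccontr)
    assume "\<not> ?thesis"
    then obtain T where T: "T \<in> empties_in_wedge K p x r" "T \<in> empties_in_wedge K p r y" by blast
    then have "T \<subseteq> {p, r}" using cdis by (fastforce simp: empties_in_wedge_def empty_triangles_def)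
    then have "card T \<le> card {p, r}" by (rule card_mono[rotated]) simp
    also have "\<dots> \<le> 2" by (simp add: card_insert_if)
    finally show False using T by (simp add: empties_in_wedge_def empty_triangles_def)
  qed
  then have "card (empties_in_wedge K p x r \<union> empties_in_wedge K p r y)
      = card (empties_in_wedge K p x r) + card (empties_in_wedge K p r y)"
    using finite_empties_in_wedge by (intro card_Un_disjoint) auto
  moreover have "empties_in_wedge K p x r \<union> empties_in_wedge K p r y \<subseteq> empties_in_wedge K p x y"
    using sub by (auto simp: empties_in_wedge_def)
  then have "card (empties_in_wedge K p x r \<union> empties_in_wedge K p r y) \<le> card (empties_in_wedge K p x y)"
    by (rule card_mono[OF finite_empties_in_wedge])
  ultimately have e: "card (empties_in_wedge K p x r) + card (empties_in_wedge K p r y) \<le> card (empties_in_wedge K p x y)"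
    by simp
  have "R \<inter> K \<inter> wedge p x y \<subseteq> insert r (R \<inter> K \<inter> wedge p x r \<union> R \<inter> K \<inter> wedge p r y)"
    using wedge_split_cover[OF p r(1) pr] by blast
  then have "card (R \<inter> K \<inter> wedge p x y) \<le> card (insert r (R \<inter> K \<inter> wedge p x r \<union> R \<inter> K \<inter> wedge p r y))"
    by (rule card_mono[rotated]) (use finite_R in simp)
  also have "\<dots> \<le> card (R \<inter> K \<inter> wedge p x r) + card (R \<inter> K \<inter> wedge p r y) + 1"
    using card_Un_le[of "R \<inter> K \<inter> wedge p x r" "R \<inter> K \<inter> wedge p r y"] 
      card_insert_le_m1[of "Suc (card (R \<inter> K \<inter> wedge p x r \<union> R \<inter> K \<inter> wedge p r y))" "R \<inter> K \<inter> wedge p x r \<union> R \<inter> K \<inter> wedge p r y" r]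
    by simp
  finally show ?thesis unfolding wedge_excess_def using b e by linarith
qed

text \<open>A red point inside splits the wedge, and superadditivity reduces to the parts. Without
  red points inside, either a blue point of \<open>K\<close> lies in the wedge or
  \<open>{p, x, y}\<close> is an empty triangle; one of them pays for the constant 1.\<close>

lemma wedge_excess_nonneg:
  assumes K: "convex K" and "p \<in> R \<inter> K" "x \<in> R \<inter> K" "y \<in> R \<inter> K" "0 < orient p x y"
  shows "0 \<le> wedge_excess K p x y"
  using assms(2-)
proof (induction "card (R \<inter> K \<inter> wedge p x y)" arbitrary: x y rule: less_induct)
  case less
  show ?case
  proof (cases "R \<inter> K \<inter> wedge p x y = {}")
    case True
    show ?thesis
    proof (cases "B \<inter> K \<inter> wedge p x y = {}")
      case False
      then have "0 < card (B \<inter> K \<inter> wedge p x y)" using finite_B by (simp add: card_gt_0_iff)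
      then show ?thesis unfolding wedge_excess_def True by simp
    next
      case Bempty: True
      let ?T = "{p, x, y}"
      have ne: "p \<noteq> x" "x \<noteq> y" "p \<noteq> y" using less.prems by auto
      have sub: "convex hull ?T \<subseteq> K" by (rule hull_minimal) (use less.prems K in auto)
      have "z \<in> ?T" if z: "z \<in> convex hull ?T" "z \<in> R \<union> B" for z
      proof (rule ccontr)
        assume n: "z \<notin> ?T"
        have "0 \<le> orient p x z" "0 \<le> orient p z y"
          using in_triangle_orient_nonneg[of p x y z] less.prems z orient_rotate[of y p z] by auto
        moreover have "orient p x z \<noteq> 0" "orient p z y \<noteq> 0"
          using orient_nonzero[of p x z] orient_nonzero[of p z y] ne n less.prems z by auto
        ultimately have "z \<in> wedge p x y" by (simp add: wedge_def)
        then show False using True Bempty z sub by blast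
      qed
      then have "?T \<in> empty_triangles"
        unfolding empty_triangles_def using less.prems ne by (auto simp: hull_inc)
      then have "?T \<in> empties_in_wedge K p x y"
        using less.prems by (auto simp: empties_in_wedge_def closed_wedge_def)
      then have "0 < card (empties_in_wedge K p x y)"
        using finite_empties_in_wedge by (auto simp: card_gt_0_iff)
      then show ?thesis unfolding wedge_excess_def True by simp
    qed
  next
    case False
    then obtain r where r: "r \<in> R" "r \<in> K" "r \<in> wedge p x y" by blast
    have o: "0 < orient p x r" "0 < orient p r y" using r by (auto simp: wedge_def)
    have lt: "card (R \<inter> K \<inter> W) < card (R \<inter> K \<inter> wedge p x y)" if "W \<subseteq> wedge p x y" "r \<notin> W" for W
      by (rule psubset_card_mono) (use that r finite_R in auto)
    note sub = wedge_split_subset[OF r(3) less.prems(4)]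
    have 1: "0 \<le> wedge_excess K p x r"
      by (intro less.hyps lt) (use sub r o less.prems in \<open>auto simp: wedge_def\<close>)
    have 2: "0 \<le> wedge_excess K p r y"
      by (intro less.hyps lt) (use sub r o less.prems in \<open>auto simp: wedge_def\<close>)
    show ?thesis using wedge_excess_split[of p r K x y] 1 2 r less.prems by auto
  qed
qed

section \<open>Excess of a triangle over a base side\<close>

definition empties_at :: "point \<Rightarrow> point set \<Rightarrow> point set set" where
  "empties_at p K = {T \<in> empty_triangles. p \<in> T \<and> T \<subseteq> K}"

lemma finite_empties_at: "finite (empties_at p K)"
  unfolding empties_at_def using finite_empty_triangles by simp

text \<open>The side \<open>px\<close> is the base: stars at both of its endpoints are counted.\<close>

definition triangle_excess :: "point \<Rightarrow> point \<Rightarrow> point \<Rightarrow> int" where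
  "triangle_excess p x v =
     int (card (B \<inter> convex hull {p, x, v})) + int (card (empties_at p (convex hull {p, x, v})))
     + int (card (empties_at x (convex hull {p, x, v})))
     - int (card (R \<inter> convex hull {p, x, v} - {p, x, v})) - 1"

lemma segment_meets_only_endpoints:
  assumes "a \<in> R" "b \<in> R" "z \<in> R \<union> B" "z \<in> convex hull {a, b}"
  shows "z = a \<or> z = b"
proof (cases "a = b")
  case True
  then show ?thesis using assms by simp
next
  case False
  then show ?thesis
    using orient_zero_if_between[OF assms(4)] orient_nonzero[of a b z] assms by blast
qed

lemma interior_in_wedge:
  assumes "p \<in> R" "x \<in> R" "y \<in> R" "0 < orient p x y"
    and "z \<in> R \<union> B" "z \<in> convex hull {p, x, y}" "z \<notin> {p, x, y}"
  shows "z \<in> wedge p x y"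
proof -
  have "0 \<le> orient p x z" "0 \<le> orient p z y"
    using in_triangle_orient_nonneg[of p x y z] assms orient_rotate[of y p z] by auto
  moreover have "p \<noteq> x" "p \<noteq> y" using assms by auto
  then have "orient p x z \<noteq> 0" "orient p z y \<noteq> 0"
    using orient_nonzero[of p x z] orient_nonzero[of p z y] assms by auto
  ultimately show ?thesis by (simp add: wedge_def)
qed

text \<open>The sweep about \<open>p\<close>, restricted to the triangle. The claim is symmetric in
  \<open>x\<close> and \<open>y\<close>, so they may be taken in counterclockwise order.\<close>

lemma star_of_vertex:
  assumes "p \<in> R" "x \<in> R" "y \<in> R" "p \<noteq> x" "p \<noteq> y" "x \<noteq> y"
  shows "card (R \<inter> convex hull {p, x, y} - {p, x, y}) + 1
    \<le> card (B \<inter> convex hull {p, x, y}) + card (empties_at p (convex hull {p, x, y}))"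
proof -
  have pos: "card (R \<inter> convex hull {p, x, y} - {p, x, y}) + 1
    \<le> card (B \<inter> convex hull {p, x, y}) + card (empties_at p (convex hull {p, x, y}))"
    if "x \<in> R" "y \<in> R" "0 < orient p x y" for x y
  proof -
    let ?K = "convex hull {p, x, y}"
    have "0 \<le> wedge_excess ?K p x y"
      by (rule wedge_excess_nonneg) (use that assms in \<open>auto simp: hull_inc\<close>)
    moreover have "card (B \<inter> ?K \<inter> wedge p x y) \<le> card (B \<inter> ?K)"
      by (rule card_mono) (use finite_B in auto)
    moreover have "card (empties_in_wedge ?K p x y) \<le> card (empties_at p ?K)"
      by (rule card_mono[OF finite_empties_at]) (auto simp: empties_at_def empties_in_wedge_def)
    moreover have "card (R \<inter> ?K - {p, x, y}) \<le> card (R \<inter> ?K \<inter> wedge p x y)"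
      by (rule card_mono) (use finite_R interior_in_wedge[of p x y] that assms in auto)
    ultimately show ?thesis unfolding wedge_excess_def by linarith
  qed
  have "orient p x y \<noteq> 0" using orient_nonzero[of p x y] assms by auto
  then consider "0 < orient p x y" | "0 < orient p y x" using orient_swap[of p x y] by linarith
  then show ?thesis
  proof cases
    case 1
    then show ?thesis using pos assms by auto
  next
    case 2
    then show ?thesis using pos[of y x] assms by (simp add: insert_commute)
  qed
qed

lemma triangle_excess_nonneg:
  assumes "p \<in> R" "x \<in> R" "y \<in> R" "p \<noteq> x" "p \<noteq> y" "x \<noteq> y"
  shows "0 \<le> triangle_excess p x y"
  using star_of_vertex[OF assms] unfolding triangle_excess_def by linarith

text \<open>The point \<open>r\<close> cuts the triangle into three. The piece over the base
  \<open>px\<close> carries its own excess; each of the other two pieces contains \<open>p\<close>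
  or \<open>x\<close> and gains at least 1 by \<open>star_of_vertex\<close>. The point
  \<open>r\<close>, now interior, takes back 1 of these 2.\<close>

lemma triangle_excess_increases:
  assumes R: "p \<in> R" "x \<in> R" "v \<in> R" "p \<noteq> x" "p \<noteq> v" "x \<noteq> v"
    and r: "r \<in> R" "r \<in> convex hull {p, x, v}" "r \<notin> {p, x, v}"
  shows "triangle_excess p x r + 1 \<le> triangle_excess p x v"
proof -
  let ?K = "convex hull {p, x, v}" and ?Kv = "convex hull {p, x, r}"
    and ?Kx = "convex hull {p, r, v}" and ?Kp = "convex hull {x, r, v}"
  have ind: "\<not> affine_dependent {p, x, v}"
    by (rule affine_independent_if_orient_nonzero) (use orient_nonzero R in auto)
  have sub: "?Kv \<subseteq> ?K" "?Kx \<subseteq> ?K" "?Kp \<subseteq> ?K"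
    using r by (simp_all add: subset_hull hull_inc)
  have cover: "?K \<subseteq> ?Kv \<union> ?Kx \<union> ?Kp"
  proof
    fix z assume "z \<in> ?K"
    from in_convex_hull_exchange[OF r(2) this] obtain b
      where b: "b \<in> {p, x, v}" "z \<in> convex hull (insert r ({p, x, v} - {b}))" by blast
    have e: "insert r ({p, x, v} - {p}) = {x, r, v}" "insert r ({p, x, v} - {x}) = {p, r, v}"
      "insert r ({p, x, v} - {v}) = {p, x, r}" using R r by auto
    from b(1) consider "b = p" | "b = x" | "b = v" by blast
    then show "z \<in> ?Kv \<union> ?Kx \<union> ?Kp" using b(2) e by cases auto
  qed
  \<comment> \<open>Two pieces meet in the segment from \<open>r\<close> to their common vertex of
    the big triangle, which carries no further coloured points. Hence blue points and empty
    triangles of different pieces are disjoint.\<close>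
  have meet: "z = a \<or> z = r" 
    if "z \<in> convex hull (insert r U)" "z \<in> convex hull (insert r V)" "U \<subseteq> {p, x, v}" "V \<subseteq> {p, x, v}"
       "U \<inter> V = {a}" "a \<in> {p, x, v}" "z \<in> R \<union> B" for z a U V
  proof -
    have "z \<in> convex hull {r, a}"
      using in_convex_hull_exchange_unique[OF ind r(2) that(3,4,1,2)] that(5) by simp
    then show ?thesis using segment_meets_only_endpoints[of r a z] r R that by auto
  qed
  have m01: "z = p \<or> z = r" if "z \<in> ?Kv" "z \<in> ?Kx" "z \<in> R \<union> B" for z
    by (rule meet[of z "{p, x}" "{p, v}"]) (use that R in \<open>auto simp: insert_commute\<close>)
  have m02: "z = x \<or> z = r" if "z \<in> ?Kv" "z \<in> ?Kp" "z \<in> R \<union> B" for z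
    by (rule meet[of z "{p, x}" "{x, v}"]) (use that R in \<open>auto simp: insert_commute\<close>)
  have m12: "z = v \<or> z = r" if "z \<in> ?Kx" "z \<in> ?Kp" "z \<in> R \<union> B" for z
    by (rule meet[of z "{p, v}" "{x, v}"]) (use that R in \<open>auto simp: insert_commute\<close>)
  have b: "card (B \<inter> ?Kv) + card (B \<inter> ?Kx) + card (B \<inter> ?Kp) \<le> card (B \<inter> ?K)"
  proof -
    have nb: "p \<notin> B" "x \<notin> B" "v \<notin> B" "r \<notin> B" using R r disjoint by auto
    have "card (B \<inter> ?Kv \<union> B \<inter> ?Kx \<union> B \<inter> ?Kp) = card (B \<inter> ?Kv \<union> B \<inter> ?Kx) + card (B \<inter> ?Kp)"
      by (rule card_Un_disjoint) (use finite_B m02 m12 nb in auto)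
    also have "card (B \<inter> ?Kv \<union> B \<inter> ?Kx) = card (B \<inter> ?Kv) + card (B \<inter> ?Kx)"
      by (rule card_Un_disjoint) (use finite_B m01 nb in auto)
    finally have "card (B \<inter> ?Kv) + card (B \<inter> ?Kx) + card (B \<inter> ?Kp) = card (B \<inter> ?Kv \<union> B \<inter> ?Kx \<union> B \<inter> ?Kp)"
      by simp
    also have "\<dots> \<le> card (B \<inter> ?K)"
      by (rule card_mono) (use finite_B sub in auto)
    finally show ?thesis .
  qed
  have e: "card (empties_at q L) + card (empties_at q M) \<le> card (empties_at q ?K)"
    if "L \<subseteq> ?K" "M \<subseteq> ?K" and LM: "\<And>z. z \<in> L \<Longrightarrow> z \<in> M \<Longrightarrow> z \<in> R \<union> B \<Longrightarrow> z = q \<or> z = r" for q L M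
  proof -
    have "empties_at q L \<inter> empties_at q M = {}"
    proof (rule ccontr)
      assume "\<not> ?thesis"
      then obtain T where T: "T \<in> empties_at q L" "T \<in> empties_at q M" by blast
      then have "T \<subseteq> {q, r}" using LM by (fastforce simp: empties_at_def empty_triangles_def)
      then have "card T \<le> card {q, r}" by (rule card_mono[rotated]) simp
      also have "\<dots> \<le> 2" by (simp add: card_insert_if)
      finally show False using T by (simp add: empties_at_def empty_triangles_def)
    qed
    then have "card (empties_at q L) + card (empties_at q M) = card (empties_at q L \<union> empties_at q M)"
      using finite_empties_at by (intro card_Un_disjoint[symmetric]) auto
    also have "\<dots> \<le> card (empties_at q ?K)"
      by (rule card_mono[OF finite_empties_at]) (use that in \<open>auto simp: empties_at_def\<close>)
    finally show ?thesis .
  qed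
  have ep: "card (empties_at p ?Kv) + card (empties_at p ?Kx) \<le> card (empties_at p ?K)"
    by (rule e) (use sub m01 in auto)
  have ex: "card (empties_at x ?Kv) + card (empties_at x ?Kp) \<le> card (empties_at x ?K)"
    by (rule e) (use sub m02 in auto)
  have "R \<inter> ?K - {p, x, v} \<subseteq> insert r ((R \<inter> ?Kv - {p, x, r}) \<union> (R \<inter> ?Kx - {p, r, v}) \<union> (R \<inter> ?Kp - {x, r, v}))"
    using cover by blast
  then have "card (R \<inter> ?K - {p, x, v}) \<le> card (insert r ((R \<inter> ?Kv - {p, x, r}) \<union> (R \<inter> ?Kx - {p, r, v}) \<union> (R \<inter> ?Kp - {x, r, v})))"
    by (rule card_mono[rotated]) (use finite_R in simp)
  also have "\<dots> \<le> card ((R \<inter> ?Kv - {p, x, r}) \<union> (R \<inter> ?Kx - {p, r, v}) \<union> (R \<inter> ?Kp - {x, r, v})) + 1"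
    using finite_R by (simp add: card_insert_if)
  also have "\<dots> \<le> card (R \<inter> ?Kv - {p, x, r}) + card (R \<inter> ?Kx - {p, r, v}) + card (R \<inter> ?Kp - {x, r, v}) + 1"
    using card_Un_le[of "(R \<inter> ?Kv - {p, x, r}) \<union> (R \<inter> ?Kx - {p, r, v})" "R \<inter> ?Kp - {x, r, v}"]
      card_Un_le[of "R \<inter> ?Kv - {p, x, r}" "R \<inter> ?Kx - {p, r, v}"] by linarith
  finally have rd: "card (R \<inter> ?K - {p, x, v})
      \<le> card (R \<inter> ?Kv - {p, x, r}) + card (R \<inter> ?Kx - {p, r, v}) + card (R \<inter> ?Kp - {x, r, v}) + 1" .
  have s1: "card (R \<inter> ?Kx - {p, r, v}) + 1 \<le> card (B \<inter> ?Kx) + card (empties_at p ?Kx)"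
    by (rule star_of_vertex) (use R r in auto)
  have s2: "card (R \<inter> ?Kp - {x, r, v}) + 1 \<le> card (B \<inter> ?Kp) + card (empties_at x ?Kp)"
    by (rule star_of_vertex) (use R r in auto)
  show ?thesis unfolding triangle_excess_def using b ep ex rd s1 s2 by linarith
qed

text \<open>If neither point is nested under the other over \<open>px\<close> or \<open>py\<close>,
  then each lies in the triangle over \<open>xy\<close> whose apex is the other. Comparing heights
  over \<open>xy\<close> forces the two points to coincide.\<close>

lemma interior_points_comparable:
  assumes xyp: "p \<in> R" "x \<in> R" "y \<in> R" "p \<noteq> x" "p \<noteq> y" "x \<noteq> y"
    and u: "u \<in> convex hull {p, x, y}" "u \<in> R" "u \<notin> {p, x, y}"
    and v: "v \<in> convex hull {p, x, y}" "v \<in> R" "v \<notin> {p, x, y}"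
    and uv: "u \<noteq> v"
  shows "u \<in> convex hull {p, x, v} \<or> v \<in> convex hull {p, x, u} \<or>
    u \<in> convex hull {p, y, v} \<or> v \<in> convex hull {p, y, u}"
proof (rule ccontr)
  assume n: "\<not> ?thesis"
  have ex: "b \<in> convex hull {a, x, y}"
    if a: "a \<in> convex hull {p, x, y}" "a \<notin> {p, x, y}" and b: "b \<in> convex hull {p, x, y}"
      and "b \<notin> convex hull {p, x, a}" "b \<notin> convex hull {p, y, a}" for a b
  proof -
    from in_convex_hull_exchange[OF a(1) b] obtain c
      where c: "c \<in> {p, x, y}" "b \<in> convex hull (insert a ({p, x, y} - {c}))" by blast
    have e: "insert a ({p, x, y} - {p}) = {a, x, y}" "insert a ({p, x, y} - {x}) = {p, y, a}"
      "insert a ({p, x, y} - {y}) = {p, x, a}" using xyp a by auto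
    from c(1) consider "c = p" | "c = x" | "c = y" by blast
    then show ?thesis using c(2) e that(4,5) by cases auto
  qed
  have "u \<in> convex hull {v, x, y}" "v \<in> convex hull {u, x, y}"
    using ex[of v u] ex[of u v] u v n by auto
  then obtain a1 a2 a3 b1 b2 b3 where
    a: "0 \<le> a1" "0 \<le> a2" "0 \<le> a3" "a1 + a2 + a3 = 1" "u = a1 *\<^sub>R v + a2 *\<^sub>R x + a3 *\<^sub>R y" and
    b: "0 \<le> b1" "0 \<le> b2" "0 \<le> b3" "b1 + b2 + b3 = 1" "v = b1 *\<^sub>R u + b2 *\<^sub>R x + b3 *\<^sub>R y"
    unfolding convex_hull_3 by blast
  \<comment> \<open>Up to a constant factor, \<open>orient x y\<close> is the height over the side
    \<open>xy\<close>. Passing from one point to the other and back multiplies it by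
    \<open>a1 * b1\<close>, with both weights at most 1.\<close>
  have "orient x y u = a1 * orient x y v"
    using orient_affine[OF a(4), of x y v x y] a(5) by simp
  moreover have "orient x y v = b1 * orient x y u"
    using orient_affine[OF b(4), of x y u x y] b(5) by simp
  ultimately have "orient x y u = (a1 * b1) * orient x y u" by simp
  moreover have "orient x y u \<noteq> 0" using orient_nonzero[of x y u] xyp u by auto
  ultimately have ab: "a1 * b1 = 1" by simp
  have "a1 \<le> 1" "b1 \<le> 1" using a b by auto
  then have "a1 = 1" using ab a(1) b(1) by (smt (verit) mult_left_le)
  then have "a2 = 0" "a3 = 0" using a by auto
  then show False using a(5) \<open>a1 = 1\<close> uv by simp
qed

text \<open>As in the Erdos-Szekeres theorem: two interior points are nested with respect to one of
  the sides \<open>px\<close> and \<open>py\<close>, so they differ in one of the two excesses.\<close>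

lemma interior_card_le_excess_product:
  assumes xyp: "p \<in> R" "x \<in> R" "y \<in> R" "p \<noteq> x" "p \<noteq> y" "x \<noteq> y"
  shows "int (card (R \<inter> convex hull {p, x, y} - {p, x, y}))
    \<le> triangle_excess p x y * triangle_excess p y x"
proof -
  let ?K = "convex hull {p, x, y}"
  let ?M = "R \<inter> ?K - {p, x, y}"
  let ?q1 = "triangle_excess p x y" and ?q2 = "triangle_excess p y x"
  define \<phi> where "\<phi> v = (triangle_excess p x v, triangle_excess p y v)" for v
  have K': "convex hull {p, y, x} = ?K" by (simp add: insert_commute)
  have "inj_on \<phi> ?M"
  proof (rule inj_onI, rule ccontr)
    fix u v assume u: "u \<in> ?M" and v: "v \<in> ?M" and eq: "\<phi> u = \<phi> v" and ne: "u \<noteq> v"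
    have h: "triangle_excess p s a + 1 \<le> triangle_excess p s b"
      if "a \<in> convex hull {p, s, b}" "a \<in> ?M" "b \<in> ?M" "a \<noteq> b" "s = x \<or> s = y" for a b s
      by (rule triangle_excess_increases) (use that xyp in auto)
    show False
      using interior_points_comparable[OF xyp, of u v] u v ne eq h[of u x v] h[of v x u] h[of u y v] h[of v y u]
      by (auto simp: \<phi>_def)
  qed
  \<comment> \<open>The intervals are half-open because an interior point has strictly smaller
    excess than the opposite vertex over the same base.\<close>
  moreover have "\<phi> ` ?M \<subseteq> {0..<?q1} \<times> {0..<?q2}"
  proof
    fix w assume "w \<in> \<phi> ` ?M"
    then obtain v where v: "v \<in> ?M" "w = \<phi> v" by blast
    have "0 \<le> triangle_excess p x v" "0 \<le> triangle_excess p y v"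
      by (rule triangle_excess_nonneg; use v xyp in auto)+
    moreover have "triangle_excess p x v + 1 \<le> ?q1" "triangle_excess p y v + 1 \<le> ?q2"
      by (rule triangle_excess_increases; use v xyp K' in auto)+
    ultimately show "w \<in> {0..<?q1} \<times> {0..<?q2}" using v by (auto simp: \<phi>_def)
  qed
  ultimately have "card ?M \<le> card ({0..<?q1} \<times> {0..<?q2})"
    by (metis card_image card_mono finite_SigmaI finite_atLeastLessThan_int)
  then have "card ?M \<le> nat (?q1 * ?q2)"
    using triangle_excess_nonneg[OF xyp] by (simp add: card_cartesian_product nat_mult_distrib)
  moreover have "0 \<le> ?q1 * ?q2"
    using triangle_excess_nonneg[OF xyp] triangle_excess_nonneg[of p y x] xyp by simp
  ultimately show ?thesis by linarith
qed

section \<open>Cutting a wedge into a fan\<close>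

text \<open>By superadditivity, shrinking the wedge on one side and then on the other discards only
  pieces of nonnegative excess. An upper bound for the view of a whole hull thus passes to every
  piece of its fan.\<close>

lemma wedge_excess_subwedge:
  assumes K: "convex K" and p: "p \<in> R \<inter> K"
    and xy: "x \<in> R \<inter> K" "y \<in> R \<inter> K" "0 < orient p x y"
    and xy': "x' \<in> R \<inter> K" "y' \<in> R \<inter> K" "0 < orient p x' y'"
    and x: "x = x' \<or> x \<in> wedge p x' y'" and y: "y = y' \<or> y \<in> wedge p x y'"
  shows "wedge_excess K p x y \<le> wedge_excess K p x' y'"
proof -
  have "0 < orient p x y'" using x xy' by (auto simp: wedge_def)
  have "wedge_excess K p x y \<le> wedge_excess K p x y'"
  proof (cases "y = y'")
    case False
    then have "y \<in> wedge p x y'" using y by simp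
    then have "0 < orient p y y'" by (simp add: wedge_def)
    then have "0 \<le> wedge_excess K p y y'" using wedge_excess_nonneg[OF K p xy(2) xy'(2)] by simp
    then show ?thesis
      using wedge_excess_split[of p y K x y'] p xy \<open>y \<in> wedge p x y'\<close> \<open>0 < orient p x y'\<close> by auto
  qed simp
  also have "\<dots> \<le> wedge_excess K p x' y'"
  proof (cases "x = x'")
    case False
    then have "x \<in> wedge p x' y'" using x by simp
    then have "0 < orient p x' x" by (simp add: wedge_def)
    then have "0 \<le> wedge_excess K p x' x" using wedge_excess_nonneg[OF K p xy'(1) xy(1)] by simp
    then show ?thesis
      using wedge_excess_split[of p x K x' y'] p xy xy' \<open>x \<in> wedge p x' y'\<close> by auto
  qed simp
  finally show ?thesis .
qed

text \<open>The rays through the points of \<open>E\<close> cut the wedge into one more piece than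
  there are such points. With 1 added to each count the bound is additive: a cut at \<open>e\<close>
  adds up the piece counts, and the extra 1 accounts for \<open>e\<close> as a red point.\<close>

lemma wedge_card_le_fan:
  fixes Q :: real
  assumes p: "p \<in> R" and E: "E \<subseteq> R" and Q: "0 \<le> Q"
    and consecutive: "\<And>x y. \<lbrakk>x \<in> E; y \<in> E; 0 < orient p x y; E \<inter> wedge p x y = {}\<rbrakk>
      \<Longrightarrow> card (R \<inter> K \<inter> wedge p x y) \<le> Q"
    and "x \<in> E" "y \<in> E" "0 < orient p x y"
  shows "card (R \<inter> K \<inter> wedge p x y) + 1 \<le> (card (E \<inter> wedge p x y) + 1) * (Q + 1)"
  using assms(5-)
proof (induction "card (E \<inter> wedge p x y)" arbitrary: x y rule: less_induct)
  case less
  show ?case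
  proof (cases "E \<inter> wedge p x y = {}")
    case True
    then show ?thesis using consecutive[OF less.prems True] by simp
  next
    case False
    then obtain e where e: "e \<in> E" "e \<in> wedge p x y" by blast
    have o: "0 < orient p x e" "0 < orient p e y" using e by (auto simp: wedge_def)
    then have pe: "p \<noteq> e" by auto
    note sub = wedge_split_subset[OF e(2) less.prems(3)]
    have fE: "finite E" using E finite_R finite_subset by blast
    have lt: "card (E \<inter> W) < card (E \<inter> wedge p x y)" if "W \<subseteq> wedge p x y" "e \<notin> W" for W
      by (rule psubset_card_mono) (use that e fE in auto)
    have nw: "e \<notin> wedge p x e" "e \<notin> wedge p e y" by (auto simp: wedge_def)
    have 1: "card (R \<inter> K \<inter> wedge p x e) + 1 \<le> (card (E \<inter> wedge p x e) + 1) * (Q + 1)"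
      by (rule less.hyps) (use lt sub nw e o less.prems in auto)
    have 2: "card (R \<inter> K \<inter> wedge p e y) + 1 \<le> (card (E \<inter> wedge p e y) + 1) * (Q + 1)"
      by (rule less.hyps) (use lt sub nw e o less.prems in auto)
    have "R \<inter> K \<inter> wedge p x y \<subseteq> insert e (R \<inter> K \<inter> wedge p x e \<union> R \<inter> K \<inter> wedge p e y)"
      using wedge_split_cover[OF p _ pe] e E by blast
    then have "card (R \<inter> K \<inter> wedge p x y) \<le> card (insert e (R \<inter> K \<inter> wedge p x e \<union> R \<inter> K \<inter> wedge p e y))"
      by (rule card_mono[rotated]) (use finite_R in simp)
    also have "\<dots> \<le> card (R \<inter> K \<inter> wedge p x e \<union> R \<inter> K \<inter> wedge p e y) + 1"
      using finite_R by (simp add: card_insert_if)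
    also have "\<dots> \<le> card (R \<inter> K \<inter> wedge p x e) + card (R \<inter> K \<inter> wedge p e y) + 1"
      using card_Un_le by simp
    finally have r: "card (R \<inter> K \<inter> wedge p x y) \<le> card (R \<inter> K \<inter> wedge p x e) + card (R \<inter> K \<inter> wedge p e y) + 1" .
    have "card (E \<inter> wedge p x e) + card (E \<inter> wedge p e y) + 1
        = card (insert e (E \<inter> wedge p x e \<union> E \<inter> wedge p e y))"
      using fE nw wedge_split_disjoint[of p x e y] by (subst card_insert_disjoint) (auto intro!: card_Un_disjoint[symmetric])
    also have "\<dots> \<le> card (E \<inter> wedge p x y)"
      by (rule card_mono) (use fE e sub in auto)
    finally have "real (card (E \<inter> wedge p x e) + card (E \<inter> wedge p e y) + 1) \<le> card (E \<inter> wedge p x y)"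
      by (rule of_nat_mono)
    then have "(card (E \<inter> wedge p x e) + 1 + (card (E \<inter> wedge p e y) + 1)) * (Q + 1) \<le> (card (E \<inter> wedge p x y) + 1) * (Q + 1)"
      using Q by (intro mult_right_mono) auto
    moreover have "real (card (R \<inter> K \<inter> wedge p x y)) \<le> card (R \<inter> K \<inter> wedge p x e) + card (R \<inter> K \<inter> wedge p e y) + 1"
      using r by linarith
    ultimately show ?thesis using 1 2 by (simp add: algebra_simps)
  qed
qed

section \<open>Extreme points and the planar bound\<close>

lemma sum_empties_at: "(\<Sum>r\<in>R. card (empties_at r UNIV)) = 3 * card empty_triangles"
  unfolding empties_at_def
proof (subst sum_multicount[of R empty_triangles "\<lambda>r T. r \<in> T" 3, symmetric])
  show "\<forall>T\<in>empty_triangles. card {r \<in> R. r \<in> T} = 3"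
  proof
    fix T assume "T \<in> empty_triangles"
    then have "{r \<in> R. r \<in> T} = T" "card T = 3" by (auto simp: empty_triangles_def)
    then show "card {r \<in> R. r \<in> T} = 3" by simp
  qed
qed (use finite_R finite_empty_triangles in auto)

text \<open>An extreme point beyond the line \<open>xy\<close> would lie outside the wedge, and then
  \<open>x\<close> or \<open>y\<close> would fall into a triangle spanned by other points of
  \<open>E\<close>. So \<open>xy\<close> bounds the hull when \<open>x\<close> and \<open>y\<close>
  are consecutive as seen from \<open>p\<close>.\<close>

lemma consecutive_extreme_halfplane:
  assumes E: "E \<subseteq> R" and ext: "\<And>e. e \<in> E \<Longrightarrow> e \<notin> convex hull (E - {e})"
    and pxy: "p \<in> E" "x \<in> E" "y \<in> E" "0 < orient p x y" and "E \<inter> wedge p x y = {}"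
    and e: "e \<in> E"
  shows "0 \<le> orient x y e"
proof (rule ccontr)
  assume "\<not> ?thesis"
  then have neg: "orient x y e < 0" by simp
  have ne: "e \<noteq> x" "e \<noteq> y" "e \<noteq> p" "p \<noteq> x" "p \<noteq> y" "x \<noteq> y" 
    using neg pxy(4) orient_rotate[of p x y] by auto
  have "e \<notin> wedge p x y" using assms by blast
  moreover have "orient p x e \<noteq> 0" "orient p e y \<noteq> 0"
    using orient_nonzero[of p x e] orient_nonzero[of p e y] ne pxy E e by auto
  ultimately consider "orient p x e < 0" | "orient p e y < 0" by (auto simp: wedge_def)
  then show False
  proof cases
    case 1
    have "x \<in> convex hull {p, e, y}"
      by (rule in_triangle_if_orient_nonneg)
        (use 1 neg pxy(4) orient_swap[of p x e] orient_rotate[of p x y] orient_rotate[of x y p]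
            orient_rotate[of e x y] orient_swap[of e x y] in \<open>auto simp: orient_def algebra_simps\<close>)
    moreover have "{p, e, y} \<subseteq> E - {x}" using ne pxy e by auto
    ultimately show False using ext[OF pxy(2)] hull_mono by blast
  next
    case 2
    have "y \<in> convex hull {p, x, e}"
      by (rule in_triangle_if_orient_nonneg)
        (use 2 neg pxy(4) orient_swap[of p e y] orient_swap[of x y e] orient_rotate[of e p y] in \<open>auto simp: orient_def algebra_simps\<close>)
    moreover have "{p, x, e} \<subseteq> E - {y}" using ne pxy e by auto
    ultimately show False using ext[OF pxy(3)] hull_mono by blast
  qed
qed

text \<open>A line separates \<open>p\<close> from the other points, so \<open>p\<close> sees them
  within an angle below pi, and there is a first and a last one in angular order.\<close>

lemma extreme_pair_about_vertex:
  assumes E: "E \<subseteq> R" "p \<in> E" "E - {p} \<noteq> {}" and p: "p \<notin> convex hull (E - {p})"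
  obtains x y where "x \<in> E - {p}" "y \<in> E - {p}"
    "\<And>e. e \<in> E - {p, x} \<Longrightarrow> 0 < orient p x e" "\<And>e. e \<in> E - {p, y} \<Longrightarrow> 0 < orient p e y"
proof -
  have fin: "finite (E - {p})" using E finite_R finite_subset by blast
  have "closed (convex hull (E - {p}))"
    using fin by (simp add: compact_imp_closed finite_imp_compact_convex_hull)
  then obtain a b where ab: "inner a p < b" "\<And>z. z \<in> convex hull (E - {p}) \<Longrightarrow> inner a z > b"
    using separating_hyperplane_closed_point[OF convex_convex_hull _ p] by blast
  \<comment> \<open>In coordinates along the separating normal \<open>a\<close> and perpendicular to
    it, \<open>c z / s z\<close> is the tangent of the angle under which \<open>p\<close> sees
    \<open>z\<close>. Its minimum and maximum give \<open>x\<close> and \<open>y\<close>.\<close>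
  define s where "s z = inner a (z - p)" for z
  define c where "c z = fst a * (snd z - snd p) - snd a * (fst z - fst p)" for z
  have s: "0 < s e" if "e \<in> E - {p}" for e
    using ab(1) ab(2)[OF hull_inc[OF that]] by (simp add: s_def inner_diff_right)
  have "a \<noteq> 0"
  proof
    assume "a = 0"
    then have "s e = 0" for e by (simp add: s_def)
    then show False using s E(3) by fastforce
  qed
  then have a: "0 < (fst a)\<^sup>2 + (snd a)\<^sup>2" by (auto simp: sum_power2_gt_zero_iff prod_eq_iff)
  have id: "((fst a)\<^sup>2 + (snd a)\<^sup>2) * orient p u v = s u * c v - c u * s v" for u v
    by (simp add: s_def c_def orient_def inner_prod_def power2_eq_square algebra_simps)
  have pos: "0 < orient p u v" if "u \<in> E - {p}" "v \<in> E - {p}" "u \<noteq> v" "c u / s u \<le> c v / s v" for u v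
  proof -
    have "0 \<le> s u * c v - c u * s v" using that s[of u] s[of v] by (simp add: field_simps)
    then have "0 \<le> orient p u v" using a id[of u v] by (metis zero_le_mult_iff not_less)
    moreover have "orient p u v \<noteq> 0" using orient_nonzero[of p u v] that E by auto
    ultimately show ?thesis by simp
  qed
  obtain x where x: "x \<in> E - {p}" "\<And>e. e \<in> E - {p} \<Longrightarrow> c x / s x \<le> c e / s e"
    using ex_min_if_finite[of "(\<lambda>e. c e / s e) ` (E - {p})"] fin E(3) by (force simp: not_less)
  obtain y where y: "y \<in> E - {p}" "\<And>e. e \<in> E - {p} \<Longrightarrow> c e / s e \<le> c y / s y"
    using ex_min_if_finite[of "(\<lambda>e. - (c e / s e)) ` (E - {p})"] fin E(3) by (force simp: not_less)
  show ?thesis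
  proof (rule that[OF x(1) y(1)])
    show "0 < orient p x e" if "e \<in> E - {p, x}" for e
      by (rule pos) (use that x in blast)+
    show "0 < orient p e y" if "e \<in> E - {p, y}" for e
      by (rule pos) (use that y in blast)+
  qed
qed

text \<open>No point inside an open segment of \<open>C\<close> is extreme. The result supplies a
  second convex set for the balance condition, one that lacks only the hull vertices.\<close>

lemma convex_remove_extreme_points:
  assumes "convex C"
  shows "convex (C - {x. x extreme_point_of C})"
  unfolding convex_contains_segment
proof (intro ballI subsetI)
  fix a b z assume h: "a \<in> C - {x. x extreme_point_of C}" "b \<in> C - {x. x extreme_point_of C}" "z \<in> closed_segment a b"
  have "z \<in> C" using h assms convex_contains_segment by blast
  moreover have "\<not> z extreme_point_of C"
    using h unfolding extreme_point_of_def open_segment_def by blast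
  ultimately show "z \<in> C - {x. x extreme_point_of C}" by simp
qed

lemma many_empty_triangles:
  fixes \<delta> :: real
  assumes \<delta>: "1 \<le> \<delta>" and N: "216 * \<delta> ^ 3 \<le> card (R \<union> B)"
    and balanced: "\<And>C. \<lbrakk>convex C; card (R \<union> B) / 4 \<le> card ((R \<union> B) \<inter> C)\<rbrakk>
      \<Longrightarrow> \<bar>real (card (R \<inter> C)) - card (B \<inter> C)\<bar> < \<delta>"
  shows "card (R \<union> B) * \<delta> / 48 \<le> card empty_triangles"
proof (rule ccontr)
  assume few: "\<not> ?thesis"
  define N where "N = real (card (R \<union> B))"
  have Nsum: "N = real (card R) + card B"
    unfolding N_def using finite_R finite_B disjoint by (simp add: card_Un_disjoint)
  have d1: "\<delta> \<le> \<delta> ^ 3" "\<delta>\<^sup>2 \<le> \<delta> ^ 3" "1 \<le> \<delta> ^ 3"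
    using \<delta> by (auto intro: self_le_power power_increasing one_le_power)
  have N1: "216 * \<delta> ^ 3 \<le> N" using N N_def by simp
  then have N2: "216 * \<delta> \<le> N" "216 \<le> N" using d1 by auto
  define Rich where "Rich = {r \<in> R. \<delta> \<le> card (empties_at r UNIV)}"
  \<comment> \<open>Each triangle is counted at its three vertices, so fewer than
    \<open>N * \<delta> / 48\<close> triangles leave fewer than \<open>N / 16\<close> rich
    points.\<close>
  have rich: "card Rich < N / 16"
  proof -
    have "card Rich * \<delta> \<le> (\<Sum>r\<in>Rich. real (card (empties_at r UNIV)))"
      using sum_bounded_below[of Rich \<delta> "\<lambda>r. real (card (empties_at r UNIV))"] by (simp add: Rich_def)
    also have "\<dots> \<le> (\<Sum>r\<in>R. real (card (empties_at r UNIV)))"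
      by (rule sum_mono2) (use finite_R in \<open>auto simp: Rich_def\<close>)
    also have "\<dots> = 3 * card empty_triangles"
      using sum_empties_at by (simp flip: of_nat_sum)
    also have "\<dots> < N / 16 * \<delta>" using few by (simp add: N_def)
    finally show ?thesis using \<delta> by simp
  qed
  define G where "G = R - Rich"
  define C where "C = convex hull G"
  define E where "E = {x. x extreme_point_of C}"
  have GR: "G \<subseteq> R" and fG: "finite G" using finite_R by (auto simp: G_def)
  have EG: "E \<subseteq> G" unfolding E_def C_def using extreme_point_of_convex_hull by blast
  have ER: "E \<subseteq> R" and fE: "finite E" using EG GR fG finite_subset by blast+
  have CE: "C = convex hull E"
    unfolding C_def E_def using fG by (intro Krein_Milman_polytope)
  have EC: "E \<subseteq> C" unfolding E_def extreme_point_of_def by blast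
  have cC: "convex C" by (simp add: C_def)
  define M where "M = card (R \<inter> C)"
  have poor: "card (empties_at r K) < \<delta>" if "r \<in> E" for r K
  proof -
    have "card (empties_at r K) \<le> card (empties_at r UNIV)"
      by (rule card_mono[OF finite_empties_at]) (auto simp: empties_at_def)
    moreover have "\<not> \<delta> \<le> card (empties_at r UNIV)" using that EG GR by (auto simp: G_def Rich_def)
    ultimately show ?thesis by linarith
  qed
  \<comment> \<open>Balance of the whole plane gives at least \<open>(N - \<delta>) / 2\<close> red
    points. Removing the rich ones leaves about \<open>7 * N / 16\<close>, and the gap to
    \<open>3 * N / 8\<close> absorbs \<delta>.\<close>
  have M: "3 * N / 8 \<le> M"
  proof -
    have "\<bar>real (card (R \<inter> UNIV)) - card (B \<inter> UNIV)\<bar> < \<delta>" by (rule balanced) auto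
    then have "(N - \<delta>) / 2 \<le> card R" using Nsum by simp
    moreover have "card G = card R - card Rich" "card Rich \<le> card R"
      unfolding G_def Rich_def using finite_R by (auto intro!: card_Diff_subset card_mono)
    moreover have "card G \<le> M"
      unfolding M_def by (rule card_mono) (use finite_R GR in \<open>auto simp: C_def hull_inc\<close>)
    ultimately show ?thesis using rich N2 by (simp add: field_simps) 
  qed
  have "card (R \<inter> C) \<le> card ((R \<union> B) \<inter> C)"
    by (rule card_mono) (use finite_R finite_B in auto)
  then have "\<bar>real M - card (B \<inter> C)\<bar> < \<delta>"
    unfolding M_def by (intro balanced cC) (use M N2 in \<open>auto simp: N_def M_def\<close>)
  then have BC: "M - \<delta> < card (B \<inter> C)" "card (B \<inter> C) < M + \<delta>" by auto
  \<comment> \<open>All hull vertices are red, so deleting them shifts the signed colour difference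
    by \<open>card E\<close> while both differences stay below \<delta> in absolute value. The blue
    points alone keep \<open>C - E\<close> above the threshold \<open>N / 4\<close>.\<close>
  have cE: "card E < 2 * \<delta>"
  proof -
    have BE: "B \<inter> (C - E) = B \<inter> C" using ER disjoint by blast
    have "card (B \<inter> (C - E)) \<le> card ((R \<union> B) \<inter> (C - E))"
      by (rule card_mono) (use finite_R finite_B in auto)
    then have "\<bar>real (card (R \<inter> (C - E))) - card (B \<inter> (C - E))\<bar> < \<delta>"
      using convex_remove_extreme_points[OF cC] BC M N2 unfolding E_def[symmetric] BE
      by (intro balanced[of "C - E", unfolded BE]) (auto simp: N_def)
    moreover have "R \<inter> (C - E) = R \<inter> C - E" by blast
    moreover have "card (R \<inter> C - E) = M - card E" "card E \<le> M"
      unfolding M_def using fE ER EC finite_R by (auto intro!: card_Diff_subset card_mono)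
    ultimately show ?thesis using BC BE by simp
  qed
  have ext: "e \<notin> convex hull (E - {e})" if "e \<in> E" for e
  proof -
    have "convex (C - {e})" using that extreme_point_of_stillconvex[OF cC] by (auto simp: E_def)
    then have "convex hull (E - {e}) \<subseteq> C - {e}" using EC by (intro hull_minimal) auto
    then show ?thesis by blast
  qed
  have "M > 2" using M N2 by linarith
  have "E \<noteq> {}" using CE M_def \<open>M > 2\<close> by auto
  then obtain p where p: "p \<in> E" by blast
  have "E - {p} \<noteq> {}"
  proof
    assume "E - {p} = {}"
    then have "E = {p}" using p by auto
    then have "R \<inter> C \<subseteq> {p}" using CE by auto
    then have "card (R \<inter> C) \<le> card {p}" by (rule card_mono[rotated]) simp
    then show False using \<open>M > 2\<close> by (simp add: M_def)
  qed
  with extreme_pair_about_vertex[OF ER p _ ext[OF p]] obtain x0 y0 where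
    xy0: "x0 \<in> E - {p}" "y0 \<in> E - {p}" and
    x0: "\<And>e. e \<in> E - {p, x0} \<Longrightarrow> 0 < orient p x0 e" and
    y0: "\<And>e. e \<in> E - {p, y0} \<Longrightarrow> 0 < orient p e y0" by blast
  have "x0 \<noteq> y0"
  proof
    assume eq: "x0 = y0"
    have "e = p \<or> e = x0" if "e \<in> E" for e
      using x0[of e] y0[of e] that eq orient_swap[of p x0 e] by fastforce
    then have "E = {p, x0}" using p xy0 by blast
    then have "R \<inter> C \<subseteq> {p, x0}" using CE segment_meets_only_endpoints[of p x0] p xy0 ER by auto
    then have "card (R \<inter> C) \<le> card {p, x0}" by (rule card_mono[rotated]) simp
    also have "\<dots> \<le> 2" by (simp add: card_insert_if)
    finally show False using \<open>M > 2\<close> by (simp add: M_def)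
  qed
  then have o0: "0 < orient p x0 y0" using x0 xy0 by auto
  have C0: "0 \<le> orient p x0 z" "0 \<le> orient p z y0" if "z \<in> C" for z
  proof -
    have "C \<subseteq> {z. 0 \<le> orient p x0 z}" unfolding CE
      by (rule hull_minimal) (use x0 in \<open>force simp: convex_orient_nonneg less_imp_le\<close>)+
    then show "0 \<le> orient p x0 z" using that by blast
    have "E \<subseteq> {z. 0 \<le> orient y0 p z}"
    proof
      fix e assume "e \<in> E"
      then show "e \<in> {z. 0 \<le> orient y0 p z}"
        using y0[of e] orient_rotate[of y0 p e] by (cases "e = p \<or> e = y0") auto
    qed
    then have "C \<subseteq> {z. 0 \<le> orient y0 p z}" unfolding CE
      by (rule hull_minimal) (rule convex_orient_nonneg)
    then show "0 \<le> orient p z y0" using that orient_rotate[of y0 p z] by auto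
  qed
  have W0: "z \<in> wedge p x0 y0" if "z \<in> R \<union> B" "z \<in> C" "z \<notin> {p, x0, y0}" for z
    using C0[OF that(2)] orient_nonzero[of p x0 z] orient_nonzero[of p z y0] that p xy0 ER
    by (fastforce simp: wedge_def)
  \<comment> \<open>Seen from \<open>p\<close>, the wedge holds all coloured points of
    \<open>C\<close> but the three vertices. There are fewer than \<open>M + \<delta>\<close> blue
    points, fewer than \<delta> empty triangles at the poor point \<open>p\<close>, and at least
    \<open>M - 3\<close> red points.\<close>
  have exc0: "wedge_excess C p x0 y0 < 2 * \<delta> + 2"
  proof -
    have "card (B \<inter> C \<inter> wedge p x0 y0) \<le> card (B \<inter> C)"
      by (rule card_mono) (use finite_B in auto)
    moreover have "card (empties_in_wedge C p x0 y0) \<le> card (empties_at p UNIV)"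
      by (rule card_mono[OF finite_empties_at]) (auto simp: empties_at_def empties_in_wedge_def)
    moreover have "card (R \<inter> C) \<le> card (R \<inter> C \<inter> wedge p x0 y0 \<union> {p, x0, y0})"
      by (rule card_mono) (use finite_R W0 in auto)
    then have "M \<le> card (R \<inter> C \<inter> wedge p x0 y0) + 3"
      unfolding M_def by (rule order_trans) (rule order_trans[OF card_Un_le], simp add: card_insert_if)
    ultimately show ?thesis unfolding wedge_excess_def using BC(2) poor[OF p, of UNIV] by simp
  qed
  \<comment> \<open>Between consecutive vertices the wedge cuts \<open>C\<close> within the triangle
    \<open>pxy\<close>. Each triangle excess is therefore at most the wedge excess plus a star at
    the poor point \<open>x\<close> or \<open>y\<close>, hence at most
    \<open>3 * \<delta> + 2 \<le> 5 * \<delta>\<close>; their product bounds the red points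
    inside.\<close>
  have consec: "card (R \<inter> C \<inter> wedge p x y) \<le> 25 * \<delta>\<^sup>2"
    if xy: "x \<in> E" "y \<in> E" "0 < orient p x y" "E \<inter> wedge p x y = {}" for x y
  proof -
    have ne: "p \<noteq> x" "p \<noteq> y" "x \<noteq> y" using xy(3) by auto
    let ?K = "convex hull {p, x, y}"
    have in_R: "p \<in> R" "x \<in> R" "y \<in> R" using p xy ER by auto
    have "C \<subseteq> {z. 0 \<le> orient x y z}" unfolding CE
      by (rule hull_minimal)
        (use consecutive_extreme_halfplane[OF ER ext p xy] in \<open>auto simp: convex_orient_nonneg\<close>)
    then have inK: "z \<in> ?K" if "z \<in> C" "z \<in> wedge p x y" for z
      using that xy(3) orient_rotate[of y p z]
      by (intro in_triangle_if_orient_nonneg) (auto simp: wedge_def)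
    have KC: "?K \<subseteq> C" using cC p xy EC by (intro hull_minimal) auto
    \<comment> \<open>Since \<open>y\<close> follows \<open>x\<close> in angular order,
      \<open>x\<close> cannot be the last point \<open>y0\<close>.\<close>
    have "x = x0 \<or> x \<in> wedge p x0 y0" 
    proof (cases "x = y0")
      case True
      then show ?thesis using y0[of y] xy ne orient_swap[of p x y] by force
    qed (use W0[of x] xy ER EC ne in auto)
    moreover have "y = y0 \<or> y \<in> wedge p x y0"
      using y0[of y] xy ne by (auto simp: wedge_def)
    ultimately have "wedge_excess C p x y \<le> wedge_excess C p x0 y0"
      by (intro wedge_excess_subwedge) (use cC p xy xy0 ER EC o0 in auto)
    then have we: "wedge_excess C p x y < 2 * \<delta> + 2" using exc0 by linarith
    have b: "card (B \<inter> ?K) \<le> card (B \<inter> C \<inter> wedge p x y)"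
    proof (rule card_mono)
      show "B \<inter> ?K \<subseteq> B \<inter> C \<inter> wedge p x y"
        using KC interior_in_wedge[OF in_R xy(3)] in_R disjoint by blast
    qed (use finite_B in simp)
    have Kw: "?K \<subseteq> closed_wedge p x y"
    proof
      fix z assume "z \<in> ?K"
      then show "z \<in> closed_wedge p x y"
        using in_triangle_orient_nonneg[of p x y z] xy(3) orient_rotate[of y p z] by (auto simp: closed_wedge_def)
    qed
    have e: "card (empties_at p ?K) \<le> card (empties_in_wedge C p x y)"
      by (rule card_mono[OF finite_empties_in_wedge])
        (use Kw KC in \<open>auto simp: empties_at_def empties_in_wedge_def\<close>)
    have r: "R \<inter> ?K - {p, x, y} = R \<inter> C \<inter> wedge p x y"
      using interior_in_wedge[OF in_R xy(3)] inK KC by (auto simp: wedge_def)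
    have 1: "triangle_excess p x y \<le> 3 * \<delta> + 2"
      using b e r we poor[OF xy(1), of ?K] unfolding triangle_excess_def wedge_excess_def by simp
    have K': "convex hull {p, y, x} = ?K" "{p, y, x} = {p, x, y}" by (simp_all add: insert_commute)
    have 2: "triangle_excess p y x \<le> 3 * \<delta> + 2"
      using b e r we poor[OF xy(2), of ?K] unfolding triangle_excess_def wedge_excess_def K' by simp
    have "real_of_int (int (card (R \<inter> C \<inter> wedge p x y))) \<le> of_int (triangle_excess p x y * triangle_excess p y x)"
      using interior_card_le_excess_product[OF in_R ne] unfolding r by linarith
    also have "\<dots> \<le> (3 * \<delta> + 2) * (3 * \<delta> + 2)"
      using 1 2 triangle_excess_nonneg[of p x y] triangle_excess_nonneg[of p y x] in_R ne \<delta>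
      by (simp add: mult_mono)
    also have "\<dots> \<le> (5 * \<delta>) * (5 * \<delta>)" using \<delta> by (intro mult_mono) auto
    finally show ?thesis by (simp add: power2_eq_square)
  qed
  have "real (card (R \<inter> C \<inter> wedge p x0 y0)) + 1 \<le> (card (E \<inter> wedge p x0 y0) + 1) * (25 * \<delta>\<^sup>2 + 1)"
    using wedge_card_le_fan[of p E "25 * \<delta>\<^sup>2" C x0 y0] consec p xy0 o0 ER by auto
  moreover have "card (R \<inter> C) \<le> card (R \<inter> C \<inter> wedge p x0 y0 \<union> {p, x0, y0})"
    by (rule card_mono) (use finite_R W0 in auto)
  then have "M \<le> card (R \<inter> C \<inter> wedge p x0 y0) + 3"
    unfolding M_def by (rule order_trans) (rule order_trans[OF card_Un_le], simp add: card_insert_if)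
  moreover have "card (E \<inter> wedge p x0 y0) + 3 \<le> card E"
  proof -
    have "card (E \<inter> wedge p x0 y0 \<union> {p, x0, y0}) = card (E \<inter> wedge p x0 y0) + card {p, x0, y0}"
      by (rule card_Un_disjoint) (use fE in \<open>auto simp: wedge_def\<close>)
    moreover have "card (E \<inter> wedge p x0 y0 \<union> {p, x0, y0}) \<le> card E"
      by (rule card_mono) (use fE p xy0 in auto)
    moreover have "card {p, x0, y0} = 3" using xy0 \<open>x0 \<noteq> y0\<close> by auto
    ultimately show ?thesis by simp
  qed
  \<comment> \<open>The vertices \<open>p\<close>, \<open>x0\<close>, \<open>y0\<close> are not in
    the open wedge, so the fan has at most \<open>card E - 2\<close> triangles.\<close>
  then have "(card (E \<inter> wedge p x0 y0) + 1) * (25 * \<delta>\<^sup>2 + 1) \<le> (2 * \<delta> - 2) * (25 * \<delta>\<^sup>2 + 1)"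
    using cE by (intro mult_right_mono) auto
  ultimately have "M \<le> (2 * \<delta> - 2) * (25 * \<delta>\<^sup>2 + 1) + 2" by linarith
  also have "\<dots> \<le> 52 * \<delta> ^ 3"
  proof -
    have "(2 * \<delta> - 2) * (25 * \<delta>\<^sup>2 + 1) + 2 = 50 * \<delta> ^ 3 + 2 * \<delta> - 50 * \<delta>\<^sup>2"
      by (simp add: power2_eq_square power3_eq_cube algebra_simps)
    then show ?thesis using d1 zero_le_power2[of \<delta>] by linarith
  qed
  \<comment> \<open>The assumption with 216 gives \<open>M \<ge> 81 * \<delta> ^ 3\<close>, against
    the upper bound \<open>52 * \<delta> ^ 3\<close>.\<close>
  finally show False using M N1 d1 by simp
qed

end

section \<open>Central projection from a red flat\<close>

text \<open>Lifting \<open>y\<close> to \<open>(y, 1)\<close> turns affine dependence into linear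
  dependence.\<close>

lemma general_position_lift_independent:
  fixes S :: "(real ^ 'n) set"
  assumes S: "finite S" "general_position S" and Y: "Y \<subseteq> S" "card Y \<le> CARD('n) + 1"
    and zero: "(\<Sum>y\<in>Y. c y *\<^sub>R (y, 1::real)) = 0" and y: "y \<in> Y"
  shows "c y = 0"
proof (rule ccontr)
  assume ne: "c y \<noteq> 0"
  have fin: "finite Y" using S Y finite_subset by blast
  have "(\<Sum>y\<in>Y. c y *\<^sub>R y) = 0" "(\<Sum>y\<in>Y. c y) = 0"
    using arg_cong[OF zero, of fst] arg_cong[OF zero, of snd] by (simp_all add: fst_sum snd_sum)
  then have "affine_dependent Y"
    unfolding affine_dependent_explicit_finite[OF fin] using ne y by blast
  then show False using S Y fin by (simp add: general_position_def)
qed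

text \<open>With \<open>d = CARD('n)\<close>, the \<open>d - 2\<close> lifted points of
  \<open>X\<close> are independent in dimension \<open>d + 1\<close>, so the functionals vanishing
  on them form a space of dimension 3, with basis \<open>f\<close>, \<open>g\<close>,
  \<open>h\<close>. They send up to three points of \<open>S - X\<close> to independent vectors,
  since a relation would lift to a dependence among at most \<open>d + 1\<close> points of
  \<open>S\<close>. The functional \<open>f\<close> is to serve as denominator and must not vanish
  on \<open>S - X\<close>.\<close>

lemma exists_central_projection:
  fixes S X :: "(real ^ 'n) set"
  assumes S: "finite S" "general_position S" and X: "X \<subseteq> S" "card X + 2 = CARD('n)"
  obtains f g h :: "(real ^ 'n) \<times> real"
  where "\<And>x. x \<in> X \<Longrightarrow> f \<bullet> (x, 1) = 0" "\<And>x. x \<in> X \<Longrightarrow> g \<bullet> (x, 1) = 0" "\<And>x. x \<in> X \<Longrightarrow> h \<bullet> (x, 1) = 0"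
    and "\<And>s. s \<in> S - X \<Longrightarrow> f \<bullet> (s, 1) \<noteq> 0"
    and "\<And>T u t. \<lbrakk>T \<subseteq> S - X; card T \<le> 3; (\<Sum>t\<in>T. u t * (f \<bullet> (t, 1))) = 0;
      (\<Sum>t\<in>T. u t * (g \<bullet> (t, 1))) = 0; (\<Sum>t\<in>T. u t * (h \<bullet> (t, 1))) = 0; t \<in> T\<rbrakk> \<Longrightarrow> u t = 0"
proof -
  define L where "L y = (y :: real ^ 'n, 1 :: real)" for y
  have injL: "inj_on L A" for A by (auto simp: inj_on_def L_def)
  have fX: "finite X" using S X finite_subset by blast
  define U where "U = span (L ` X)"
  define V where "V = U\<^sup>\<bottom>"
  have sV: "subspace V" unfolding V_def by (rule subspace_orthogonal_comp)
  have "independent (L ` X)"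
  proof -
    have "c v = 0" if zero: "(\<Sum>v\<in>L ` X. c v *\<^sub>R v) = 0" and v: "v \<in> L ` X" for c v
    proof -
      obtain x where x: "x \<in> X" "v = L x" using v by blast
      have "(\<Sum>y\<in>X. c (L y) *\<^sub>R (y, 1::real)) = 0"
        using zero unfolding sum.reindex[OF injL] o_def L_def .
      then show ?thesis
        using general_position_lift_independent[OF S X(1), of "\<lambda>y. c (L y)" x] x X by simp
    qed
    then show ?thesis using fX by (intro independent_if_scalars_zero) auto
  qed
  then have "dim U = card X" unfolding U_def using injL by (simp add: dim_eq_card_independent card_image)
  moreover have "dim {y \<in> UNIV. \<forall>x\<in>U. orthogonal x y} + dim U = dim (UNIV :: ((real ^ 'n) \<times> real) set)"
    by (rule dim_subspace_orthogonal_to_vectors) (auto simp: U_def)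
  ultimately have dV: "dim V = 3" using X by (simp add: V_def orthogonal_comp_def)
  obtain D where D: "D \<subseteq> V" "independent D" "card D = dim V" "span D = V"
    using orthonormal_basis_subspace[OF sV] by metis
  obtain e1 e2 e3 where e: "D = {e1, e2, e3}" using D(3) dV by (auto simp: card_3_iff)
  \<comment> \<open>A combination of lifts killed by all of \<open>D\<close> is orthogonal to
    \<open>V\<close>, so it lies in the span of the lifted \<open>X\<close>; this is a relation on
    \<open>X \<union> T\<close>.\<close>
  have core: "u t = 0"
    if T: "T \<subseteq> S - X" "card T \<le> 3" "\<And>e. e \<in> D \<Longrightarrow> (\<Sum>t\<in>T. u t * (e \<bullet> L t)) = 0" "t \<in> T" for T u t
  proof -
    have fT: "finite T" using T S finite_subset by blast
    define w where "w = (\<Sum>t\<in>T. u t *\<^sub>R L t)"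
    have "e \<bullet> w = 0" if "e \<in> D" for e
      using T(3)[OF that] by (simp add: w_def inner_sum_right)
    then have "orthogonal w v" if "v \<in> V" for v
      using that D(4) orthogonal_to_span[of v D w] by (auto simp: orthogonal_def inner_commute)
    then have "w \<in> V\<^sup>\<bottom>" by (auto simp: orthogonal_comp_def orthogonal_commute)
    then have "w \<in> span (L ` X)" unfolding V_def U_def by (simp add: orthogonal_comp_self)
    then obtain q where "w = (\<Sum>v\<in>L ` X. q v *\<^sub>R v)" using fX by (auto simp: span_finite)
    then have q: "w = (\<Sum>x\<in>X. q (L x) *\<^sub>R L x)" by (simp add: sum.reindex[OF injL])
    define c where "c z = (if z \<in> T then u z else - q (L z))" for z
    have dj: "X \<inter> T = {}" using T by blast
    have "(\<Sum>z\<in>X \<union> T. c z *\<^sub>R L z) = (\<Sum>z\<in>X. c z *\<^sub>R L z) + (\<Sum>z\<in>T. c z *\<^sub>R L z)"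
      by (rule sum.union_disjoint[OF fX fT dj])
    also have "(\<Sum>z\<in>X. c z *\<^sub>R L z) = - w"
      unfolding q sum_negf[symmetric] by (rule sum.cong) (use dj in \<open>auto simp: c_def\<close>)
    also have "(\<Sum>z\<in>T. c z *\<^sub>R L z) = w" unfolding w_def by (simp add: c_def)
    finally have "(\<Sum>z\<in>X \<union> T. c z *\<^sub>R (z, 1::real)) = 0" by (simp add: L_def)
    moreover have "card (X \<union> T) \<le> CARD('n) + 1" using card_Un_le[of X T] X T by linarith
    ultimately have "c t = 0"
      using general_position_lift_independent[OF S, of "X \<union> T" c t] X T by auto
    then show ?thesis using T by (simp add: c_def)
  qed
  \<comment> \<open>Candidates for \<open>f\<close> run along a moment curve. The parameters for
    which \<open>f\<close> vanishes at \<open>s\<close> are the roots of \<open>pol s\<close>, so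
    only finitely many are bad.\<close>
  define pol where "pol s = [:e1 \<bullet> L s, e2 \<bullet> L s, e3 \<bullet> L s:]" for s
  have "pol s \<noteq> 0" if "s \<in> S - X" for s
  proof
    assume "pol s = 0"
    then have "(\<Sum>t\<in>{s}. 1 * (d \<bullet> L t)) = 0" if "d \<in> D" for d using that by (auto simp: pol_def e)
    then show False using core[of "{s}" "\<lambda>_. 1" s] that by simp
  qed
  then have "finite (\<Union>s\<in>S - X. {t. poly (pol s) t = 0})"
    using S by (intro finite_UN_I) (auto intro: poly_roots_finite)
  then obtain t where t: "t \<notin> (\<Union>s\<in>S - X. {t. poly (pol s) t = 0})"
    using ex_new_if_finite infinite_UNIV_char_0 by blast
  define f where "f = e1 + t *\<^sub>R e2 + t\<^sup>2 *\<^sub>R e3"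
  have fL: "f \<bullet> v = e1 \<bullet> v + t * (e2 \<bullet> v) + t\<^sup>2 * (e3 \<bullet> v)" for v
    by (simp add: f_def inner_add_left)
  have z: "d \<bullet> (x, 1) = 0" if "d \<in> D" "x \<in> X" for d x
  proof -
    have "d \<in> V" "(x, 1) \<in> U" using that D by (auto simp: U_def L_def intro: span_base)
    then show ?thesis by (auto simp: V_def orthogonal_comp_def orthogonal_def inner_commute)
  qed
  show ?thesis
  proof (rule that[of f e2 e3])
    show "f \<bullet> (x, 1) = 0" "e2 \<bullet> (x, 1) = 0" "e3 \<bullet> (x, 1) = 0" if "x \<in> X" for x
      using z[OF _ that] by (auto simp: fL e)
    show "f \<bullet> (s, 1) \<noteq> 0" if "s \<in> S - X" for s
    proof -
      have "poly (pol s) t \<noteq> 0" using t that by blast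
      then show ?thesis by (simp add: pol_def fL L_def power2_eq_square algebra_simps)
    qed
    fix T u y
    assume T: "T \<subseteq> S - X" "card T \<le> 3" "(\<Sum>t\<in>T. u t * (f \<bullet> (t, 1))) = 0"
      "(\<Sum>t\<in>T. u t * (e2 \<bullet> (t, 1))) = 0" "(\<Sum>t\<in>T. u t * (e3 \<bullet> (t, 1))) = 0" "y \<in> T"
    have "(\<Sum>s\<in>T. u s * (f \<bullet> (s, 1))) = (\<Sum>s\<in>T. u s * (e1 \<bullet> (s, 1)))
        + t * (\<Sum>s\<in>T. u s * (e2 \<bullet> (s, 1))) + t\<^sup>2 * (\<Sum>s\<in>T. u s * (e3 \<bullet> (s, 1)))"
      by (simp add: fL sum.distrib sum_distrib_left algebra_simps)
    then have "(\<Sum>s\<in>T. u s * (e1 \<bullet> (s, 1))) = 0" using T by simp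
    then show "u y = 0" using core[of T u y] T by (auto simp: e L_def)
  qed
qed

text \<open>An affine chart of the projection from \<open>X\<close>: the hyperplane on which
  \<open>f\<close> vanishes, which contains \<open>X\<close>, goes to infinity.\<close>

definition central_projection ::
    "'a \<times> real \<Rightarrow> 'a \<times> real \<Rightarrow> 'a \<times> real \<Rightarrow> 'a::euclidean_space \<Rightarrow> point" where
  "central_projection f g h y =
     ((g \<bullet> (y, 1)) / (f \<bullet> (y, 1)), (h \<bullet> (y, 1)) / (f \<bullet> (y, 1)))"

text \<open>Where the denominator is positive, a convex combination maps to a convex combination of
  the images, with weights multiplied by the denominators and normalised.\<close>

lemma convex_central_preimage:
  fixes f g h :: "'a::euclidean_space \<times> real"
  assumes C: "convex C"
  shows "convex {y. 0 < f \<bullet> (y, 1) \<and> central_projection f g h y \<in> C}"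
  unfolding convex_def
proof (intro ballI allI impI)
  let ?K = "{y. 0 < f \<bullet> (y, 1) \<and> central_projection f g h y \<in> C}"
  fix y z and u v :: real
  assume y: "y \<in> ?K" and z: "z \<in> ?K" and uv: "0 \<le> u" "0 \<le> v" "u + v = 1"
  define w where "w = u *\<^sub>R y + v *\<^sub>R z"
  have lin: "e \<bullet> (w, 1) = u * (e \<bullet> (y, 1)) + v * (e \<bullet> (z, 1))" for e :: "'a \<times> real"
  proof -
    have "(w, 1) = u *\<^sub>R (y, 1::real) + v *\<^sub>R (z, 1)" using uv by (simp add: w_def)
    then show ?thesis by (simp only: inner_add_right inner_scaleR_right)
  qed
  define a b where "a = f \<bullet> (y, 1)" and "b = f \<bullet> (z, 1)"
  have ab: "0 < a" "0 < b" using y z by (auto simp: a_def b_def)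
  have fw: "f \<bullet> (w, 1) = u * a + v * b" by (simp add: lin a_def b_def)
  have pos: "0 < u * a + v * b"
    using ab uv by (cases "u = 0") (auto intro: add_pos_nonneg)
  have "(u * a / (u * a + v * b)) *\<^sub>R ((g \<bullet> (y, 1)) / a, (h \<bullet> (y, 1)) / a)
      + (v * b / (u * a + v * b)) *\<^sub>R ((g \<bullet> (z, 1)) / b, (h \<bullet> (z, 1)) / b) \<in> C"
    using y z uv ab pos by (intro convexD[OF C]) (auto simp: central_projection_def a_def[symmetric] b_def[symmetric] simp flip: add_divide_distrib)
  moreover have "(u * a / (u * a + v * b)) *\<^sub>R ((g \<bullet> (y, 1)) / a, (h \<bullet> (y, 1)) / a)
      + (v * b / (u * a + v * b)) *\<^sub>R ((g \<bullet> (z, 1)) / b, (h \<bullet> (z, 1)) / b)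
      = central_projection f g h w"
    using ab by (simp add: central_projection_def fw lin[of g] lin[of h] add_divide_distrib)
  ultimately show "u *\<^sub>R y + v *\<^sub>R z \<in> ?K" using pos fw by (simp add: w_def)
qed

section \<open>Lifting planar triangles to simplices\<close>

definition empty_red_vertex_sets ::
    "(real ^ 'n) set \<Rightarrow> (real ^ 'n) set \<Rightarrow> (real ^ 'n) set set" where
  "empty_red_vertex_sets S R = {T. spans_empty_simplex S T \<and> T \<subseteq> R}"

text \<open>An empty simplex determines its vertex set as its intersection with
  \<open>S\<close>.\<close>

lemma card_empty_red_simplices:
  "card (empty_red_simplices S R) = card (empty_red_vertex_sets S R)"
proof -
  have "empty_red_simplices S R = (\<lambda>T. convex hull T) ` empty_red_vertex_sets S R"
    by (auto simp: empty_red_simplices_def empty_red_vertex_sets_def)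
  moreover have "inj_on (\<lambda>T. convex hull T) (empty_red_vertex_sets S R)"
    by (rule inj_onI) (metis (mono_tags, lifting) empty_red_vertex_sets_def mem_Collect_eq spans_empty_simplex_def)
  ultimately show ?thesis by (simp add: card_image)
qed

text \<open>The richer side of the hyperplane keeps at least a quarter of \<open>S\<close>. This
  turns the planar constants 216, 4 and 48 into 864, 16 and 192.\<close>

lemma many_empty_simplices_containing:
  fixes S R B X :: "(real ^ 'n) set" and \<delta> :: real
  assumes S: "finite S" "general_position S" "S = R \<union> B" "R \<inter> B = {}"
    and X: "X \<subseteq> R" "card X + 2 = CARD('n)"
    and \<delta>: "1 \<le> \<delta>" and n: "864 * \<delta> ^ 3 \<le> card S" "2 * CARD('n) \<le> card S"
    and balanced: "\<And>C. \<lbrakk>convex C; card S / 16 \<le> card (S \<inter> C)\<rbrakk> \<Longrightarrow> discrepancy (C \<inter> R) (C \<inter> B) < \<delta>"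
  shows "card S * \<delta> / 192 \<le> card {T \<in> empty_red_vertex_sets S R. X \<subseteq> T}"
proof -
  have XS: "X \<subseteq> S" using X S by auto
  have fX: "finite X" using XS S finite_subset by blast
  obtain f0 g h :: "(real ^ 'n) \<times> real" where
    fX0: "\<And>x. x \<in> X \<Longrightarrow> f0 \<bullet> (x, 1) = 0" and gX: "\<And>x. x \<in> X \<Longrightarrow> g \<bullet> (x, 1) = 0"
    and hX: "\<And>x. x \<in> X \<Longrightarrow> h \<bullet> (x, 1) = 0"
    and f0S: "\<And>s. s \<in> S - X \<Longrightarrow> f0 \<bullet> (s, 1) \<noteq> 0"
    and ind0: "\<And>T u t. \<lbrakk>T \<subseteq> S - X; card T \<le> 3; (\<Sum>t\<in>T. u t * (f0 \<bullet> (t, 1))) = 0;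
      (\<Sum>t\<in>T. u t * (g \<bullet> (t, 1))) = 0; (\<Sum>t\<in>T. u t * (h \<bullet> (t, 1))) = 0; t \<in> T\<rbrakk> \<Longrightarrow> u t = 0"
    by (rule exists_central_projection[OF S(1,2) XS X(2)]) (rule that)
  obtain \<sigma> :: real where \<sigma>: "\<sigma> = 1 \<or> \<sigma> = -1"
    and half: "card (S - X) \<le> 2 * card {s \<in> S. 0 < \<sigma> * (f0 \<bullet> (s, 1))}"
  proof -
    let ?P = "{s \<in> S. 0 < 1 * (f0 \<bullet> (s, 1))}" and ?N = "{s \<in> S. 0 < -1 * (f0 \<bullet> (s, 1))}"
    have "S - X \<subseteq> ?P \<union> ?N" using f0S by force
    then have "card (S - X) \<le> card (?P \<union> ?N)" by (rule card_mono[rotated]) (use S in simp)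
    also have "\<dots> \<le> card ?P + card ?N" by (rule card_Un_le)
    finally have "card (S - X) \<le> 2 * card ?P \<or> card (S - X) \<le> 2 * card ?N" by linarith
    then show ?thesis using that[of 1] that[of "-1"] by blast
  qed
  define f where "f = \<sigma> *\<^sub>R f0"
  have f: "f \<bullet> v = \<sigma> * (f0 \<bullet> v)" for v by (simp add: f_def)
  define H where "H = {s. 0 < f \<bullet> (s, 1)}"
  define P where "P = central_projection f g h"
  have fX': "f \<bullet> (x, 1) = 0" if "x \<in> X" for x using fX0[OF that] by (simp add: f)
  have fS: "f \<bullet> (s, 1) \<noteq> 0" if "s \<in> S - X" for s using f0S[OF that] \<sigma> by (auto simp: f)
  have SH: "S \<inter> H \<subseteq> S - X" using fX' by (force simp: H_def)
  have ind: "u t = 0"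
    if "T \<subseteq> S \<inter> H" "card T \<le> 3" "(\<Sum>t\<in>T. u t * (f \<bullet> (t, 1))) = 0"
      "(\<Sum>t\<in>T. (u t * (f \<bullet> (t, 1))) *\<^sub>R P t) = 0" "t \<in> T" for T u t
  proof (rule ind0[of T])
    show "T \<subseteq> S - X" using that SH by blast
    have *: "(\<Sum>t\<in>T. u t * (f \<bullet> (t, 1))) = \<sigma> * (\<Sum>t\<in>T. u t * (f0 \<bullet> (t, 1)))"
      by (simp add: f sum_distrib_left algebra_simps)
    show "(\<Sum>t\<in>T. u t * (f0 \<bullet> (t, 1))) = 0" using that(3) \<sigma> unfolding * by auto
    have pos: "f \<bullet> (t, 1) \<noteq> 0" if "t \<in> T" for t using \<open>T \<subseteq> S \<inter> H\<close> that by (auto simp: H_def)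
    have "(\<Sum>t\<in>T. u t * (g \<bullet> (t, 1))) = fst (\<Sum>t\<in>T. (u t * (f \<bullet> (t, 1))) *\<^sub>R P t)"
      unfolding fst_sum by (rule sum.cong) (use pos in \<open>auto simp: P_def central_projection_def\<close>)
    then show "(\<Sum>t\<in>T. u t * (g \<bullet> (t, 1))) = 0" using that by simp
    have "(\<Sum>t\<in>T. u t * (h \<bullet> (t, 1))) = snd (\<Sum>t\<in>T. (u t * (f \<bullet> (t, 1))) *\<^sub>R P t)"
      unfolding snd_sum by (rule sum.cong) (use pos in \<open>auto simp: P_def central_projection_def\<close>)
    then show "(\<Sum>t\<in>T. u t * (h \<bullet> (t, 1))) = 0" using that by simp
  qed (use that in auto)
  \<comment> \<open>Dividing the weights by the denominators turns an affine relation among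
    projected points into one covered by \<open>ind\<close>. This gives injectivity of
    \<open>P\<close> and general position of the image.\<close>
  have ind': "v t = 0"
    if T: "T \<subseteq> S \<inter> H" "card T \<le> 3" "(\<Sum>t\<in>T. v t) = 0" "(\<Sum>t\<in>T. v t *\<^sub>R P t) = 0" "t \<in> T" for T t and v :: "_ \<Rightarrow> real"
  proof -
    have pos: "f \<bullet> (t, 1) \<noteq> 0" if "t \<in> T" for t using T(1) that by (auto simp: H_def)
    have "v t / (f \<bullet> (t, 1)) = 0"
    proof (rule ind[OF T(1,2) _ _ T(5)])
      show "(\<Sum>t\<in>T. v t / (f \<bullet> (t, 1)) * (f \<bullet> (t, 1))) = 0"
        using T(3) pos by (metis (mono_tags, lifting) nonzero_eq_divide_eq sum.cong)
      show "(\<Sum>t\<in>T. (v t / (f \<bullet> (t, 1)) * (f \<bullet> (t, 1))) *\<^sub>R P t) = 0"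
        unfolding T(4)[symmetric] by (rule sum.cong) (use pos in auto)
    qed
    then show ?thesis using pos T(5) by simp
  qed
  have injP: "inj_on P (S \<inter> H)"
  proof (rule inj_onI, rule ccontr)
    fix a b assume ab: "a \<in> S \<inter> H" "b \<in> S \<inter> H" "P a = P b" "a \<noteq> b"
    have "(\<lambda>t. if t = a then 1 else - 1 :: real) a = 0"
      by (rule ind'[of "{a, b}"]) (use ab in auto)
    then show False by simp
  qed
  have nz: "orient (P a) (P b) (P c) \<noteq> 0"
    if abc: "a \<in> S \<inter> H" "b \<in> S \<inter> H" "c \<in> S \<inter> H" "a \<noteq> b" "b \<noteq> c" "a \<noteq> c" for a b c
  proof
    assume 0: "orient (P a) (P b) (P c) = 0"
    have "P a \<noteq> P b" using injP abc by (auto dest: inj_onD)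
    then obtain t where t: "P c = P a + t *\<^sub>R (P b - P a)" using collinear_if_orient_zero[OF 0] by blast
    define v where "v s = (if s = c then - 1 else if s = b then t else 1 - t)" for s
    have "v c = 0"
    proof (rule ind'[of "{a, b, c}"])
      show "(\<Sum>s\<in>{a, b, c}. v s *\<^sub>R P s) = 0"
        using abc t by (simp add: v_def algebra_simps)
    qed (use abc in \<open>auto simp: v_def\<close>)
    then show False by (simp add: v_def)
  qed
  define R' B' where "R' = P ` (R \<inter> H)" and "B' = P ` (B \<inter> H)"
  have SU: "R' \<union> B' = P ` (S \<inter> H)" using S by (auto simp: R'_def B'_def)
  have RS: "R \<inter> H \<subseteq> S \<inter> H" "B \<inter> H \<subseteq> S \<inter> H" using S by auto
  have fin: "finite (S \<inter> H)" "finite R" "finite B" using S by auto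
  interpret plane: two_coloured_plane R' B'
  proof
    show "finite R'" "finite B'" using fin by (auto simp: R'_def B'_def)
    show "R' \<inter> B' = {}"
      unfolding R'_def B'_def using inj_on_image_Int[OF injP RS] S by auto
    fix a b c assume "a \<in> R' \<union> B'" "b \<in> R' \<union> B'" "c \<in> R' \<union> B'" "a \<noteq> b" "b \<noteq> c" "a \<noteq> c"
    then show "orient a b c \<noteq> 0" unfolding SU using nz by auto
  qed
  have cN: "card (R' \<union> B') = card (S \<inter> H)" unfolding SU using injP by (rule card_image)
  have big: "card S / 4 \<le> card (R' \<union> B')"
  proof -
    have "{s \<in> S. 0 < \<sigma> * (f0 \<bullet> (s, 1))} = S \<inter> H" by (auto simp: H_def f)
    then have "card S - card X \<le> 2 * card (S \<inter> H)" using half fX XS by (simp add: card_Diff_subset)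
    then show ?thesis using n(2) X(2) unfolding cN by linarith
  qed
  have many: "card (R' \<union> B') * \<delta> / 48 \<le> card plane.empty_triangles"
  proof (rule plane.many_empty_triangles[OF \<delta>])
    show "216 * \<delta> ^ 3 \<le> card (R' \<union> B')" using big n(1) by linarith
    fix C assume C: "convex C" and le: "card (R' \<union> B') / 4 \<le> card ((R' \<union> B') \<inter> C)"
    define C' where "C' = {y. 0 < f \<bullet> (y, 1) \<and> P y \<in> C}"
    have cv: "convex C'" unfolding C'_def P_def using convex_central_preimage[OF C] .
    have im: "card (P ` (A \<inter> H) \<inter> C) = card (A \<inter> C')" if "A \<subseteq> S" for A
    proof -
      have "P ` (A \<inter> H) \<inter> C = P ` (A \<inter> C')" by (auto simp: C'_def H_def)
      moreover have "inj_on P (A \<inter> C')" by (rule inj_on_subset[OF injP]) (use that in \<open>auto simp: C'_def H_def\<close>)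
      ultimately show ?thesis by (simp add: card_image)
    qed
    have "card S / 16 \<le> card (S \<inter> C')" using le big im[of S] unfolding SU by simp
    then have "discrepancy (C' \<inter> R) (C' \<inter> B) < \<delta>" by (rule balanced[OF cv])
    then show "\<bar>real (card (R' \<inter> C)) - card (B' \<inter> C)\<bar> < \<delta>"
      using im[of R] im[of B] S by (simp add: discrepancy_def R'_def B'_def Int_commute)
  qed
  define lift where "lift T' = X \<union> {s \<in> S \<inter> H. P s \<in> T'}" for T'
  have liftin: "lift T' \<in> {T \<in> empty_red_vertex_sets S R. X \<subseteq> T}" if T': "T' \<in> plane.empty_triangles" for T'
  proof -
    define T0 where "T0 = {s \<in> S \<inter> H. P s \<in> T'}"
    have T'R: "T' \<subseteq> R'" "card T' = 3" "convex hull T' \<inter> (R' \<union> B') = T'"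
      using T' by (auto simp: plane.empty_triangles_def)
    have "T' \<subseteq> P ` (S \<inter> H)" using T'R(1) SU by blast
    then have PT0: "P ` T0 = T'" unfolding T0_def by blast
    have T0S: "T0 \<subseteq> S \<inter> H" by (auto simp: T0_def)
    have inj0: "inj_on P T0" using injP T0S inj_on_subset by blast
    have fT0: "finite T0" using fin(1) T0S finite_subset by blast
    have c0: "card T0 = 3" using card_image[OF inj0] PT0 T'R by simp
    have T0R: "T0 \<subseteq> R"
    proof
      fix s assume s: "s \<in> T0"
      then have "P s \<in> P ` (R \<inter> H)" using PT0 T'R(1) R'_def by blast
      then obtain r where "r \<in> R \<inter> H" "P s = P r" by blast
      then show "s \<in> R" using inj_onD[OF injP, of s r] s T0S RS by auto
    qed
    have dj: "X \<inter> T0 = {}" using T0S SH by blast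
    define T where "T = X \<union> T0"
    have fT: "finite T" using fX fT0 by (simp add: T_def)
    have cT: "card T = CARD('n) + 1" unfolding T_def using card_Un_disjoint[OF fX fT0 dj] c0 X by simp
    have TS: "T \<subseteq> S" using XS T0S by (auto simp: T_def)
    have "s \<in> T" if s: "s \<in> convex hull T" "s \<in> S" for s
    proof (cases "s \<in> X")
      case False
      obtain w where w: "\<And>t. t \<in> T \<Longrightarrow> 0 \<le> w t" "sum w T = 1" "(\<Sum>t\<in>T. w t *\<^sub>R t) = s"
        using s(1) unfolding convex_hull_finite[OF fT] by auto
      \<comment> \<open>Functionals vanishing on \<open>X\<close> see only the part of the convex
        combination on \<open>T0\<close>. Hence \<open>s\<close> is on the positive side, and
        \<open>P s\<close> is a convex combination of the vertices of the empty triangle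
        \<open>T'\<close>.\<close>
      have lin: "e \<bullet> (s, 1) = (\<Sum>t\<in>T0. w t * (e \<bullet> (t, 1)))" if "\<And>x. x \<in> X \<Longrightarrow> e \<bullet> (x, 1) = 0"
        for e :: "(real ^ 'n) \<times> real"
      proof -
        have "(s, 1) = (\<Sum>t\<in>T. w t *\<^sub>R (t, 1::real))" using w by (simp add: prod_eq_iff fst_sum snd_sum)
        then have "e \<bullet> (s, 1) = (\<Sum>t\<in>T. w t * (e \<bullet> (t, 1)))" by (simp only: inner_sum_right inner_scaleR_right)
        also have "\<dots> = (\<Sum>t\<in>X. w t * (e \<bullet> (t, 1))) + (\<Sum>t\<in>T0. w t * (e \<bullet> (t, 1)))"
          unfolding T_def by (rule sum.union_disjoint[OF fX fT0 dj])
        finally show ?thesis using that by simp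
      qed
      have fpos: "0 < f \<bullet> (t, 1)" if "t \<in> T0" for t using that T0S by (auto simp: H_def)
      define A where "A = f \<bullet> (s, 1)"
      have A: "A = (\<Sum>t\<in>T0. w t * (f \<bullet> (t, 1)))" unfolding A_def using fX' by (rule lin)
      have "0 \<le> A" unfolding A using w fpos by (intro sum_nonneg) (auto simp: T_def less_imp_le)
      moreover have "A \<noteq> 0" unfolding A_def using fS s False by auto
      ultimately have Apos: "0 < A" by simp
      then have sH: "s \<in> S \<inter> H" using s by (simp add: H_def A_def)
      define \<mu> where "\<mu> t = w t * (f \<bullet> (t, 1)) / A" for t
      have "P s = (\<Sum>t\<in>T0. \<mu> t *\<^sub>R P t)"
      proof (rule prod_eqI)
        have "fst (P s) = (\<Sum>t\<in>T0. w t * (g \<bullet> (t, 1))) / A"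
          using lin[of g] gX by (simp add: P_def central_projection_def A_def)
        also have "\<dots> = fst (\<Sum>t\<in>T0. \<mu> t *\<^sub>R P t)"
          unfolding fst_sum sum_divide_distrib
          by (rule sum.cong) (use fpos in \<open>auto simp: P_def central_projection_def \<mu>_def less_imp_neq[symmetric]\<close>)
        finally show "fst (P s) = fst (\<Sum>t\<in>T0. \<mu> t *\<^sub>R P t)" .
        have "snd (P s) = (\<Sum>t\<in>T0. w t * (h \<bullet> (t, 1))) / A"
          using lin[of h] hX by (simp add: P_def central_projection_def A_def)
        also have "\<dots> = snd (\<Sum>t\<in>T0. \<mu> t *\<^sub>R P t)"
          unfolding snd_sum sum_divide_distrib
          by (rule sum.cong) (use fpos in \<open>auto simp: P_def central_projection_def \<mu>_def less_imp_neq[symmetric]\<close>)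
        finally show "snd (P s) = snd (\<Sum>t\<in>T0. \<mu> t *\<^sub>R P t)" .
      qed
      moreover have "(\<Sum>t\<in>T0. \<mu> t *\<^sub>R P t) \<in> convex hull T'"
      proof (rule convex_sum[OF fT0 convex_convex_hull])
        show "(\<Sum>t\<in>T0. \<mu> t) = 1" unfolding \<mu>_def using A Apos by (simp flip: sum_divide_distrib)
        show "0 \<le> \<mu> t" if "t \<in> T0" for t
          unfolding \<mu>_def using w(1)[of t] fpos[OF that] Apos that by (simp add: T_def)
        show "P t \<in> convex hull T'" if "t \<in> T0" for t using that PT0 by (auto intro: hull_inc)
      qed
      ultimately have "P s \<in> convex hull T'" by simp
      moreover have "P s \<in> R' \<union> B'" using SU sH by blast
      ultimately have "P s \<in> T'" using T'R(3) by blast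
      then show ?thesis using sH by (simp add: T_def T0_def)
    qed (simp add: T_def)
    then have "convex hull T \<inter> S = T" using TS hull_subset by fastforce
    moreover have "lift T' = T" by (simp add: lift_def T_def T0_def)
    ultimately show ?thesis
      using TS cT T0R X(1) by (auto simp: empty_red_vertex_sets_def spans_empty_simplex_def T_def)
  qed
  have "inj_on lift plane.empty_triangles"
  proof (rule inj_onI)
    fix T1 T2 assume T: "T1 \<in> plane.empty_triangles" "T2 \<in> plane.empty_triangles" "lift T1 = lift T2"
    have inverse: "P ` (lift T' - X) = T'" if "T' \<in> plane.empty_triangles" for T'
    proof -
      have "lift T' - X = {s \<in> S \<inter> H. P s \<in> T'}" using SH by (auto simp: lift_def)
      moreover have "T' \<subseteq> P ` (S \<inter> H)" using that SU unfolding plane.empty_triangles_def by blast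
      ultimately show ?thesis by blast
    qed
    show "T1 = T2" using inverse[OF T(1)] inverse[OF T(2)] unfolding T(3) by (rule trans[OF sym])
  qed
  moreover have "finite {T \<in> empty_red_vertex_sets S R. X \<subseteq> T}"
    by (rule finite_subset[of _ "Pow S"]) (use S in \<open>auto simp: empty_red_vertex_sets_def\<close>)
  ultimately have le: "card plane.empty_triangles \<le> card {T \<in> empty_red_vertex_sets S R. X \<subseteq> T}"
    using liftin by (intro card_inj_on_le[of lift]) auto
  have "card S * \<delta> / 192 = card S / 4 * (\<delta> / 48)" by simp
  also have "\<dots> \<le> card (R' \<union> B') * (\<delta> / 48)"
    using big \<delta> by (intro mult_right_mono) auto
  also have "\<dots> = card (R' \<union> B') * \<delta> / 48" by simp
  also note many
  also have "real (card plane.empty_triangles) \<le> card {T \<in> empty_red_vertex_sets S R. X \<subseteq> T}"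
    using le by simp
  finally show ?thesis .
qed

section \<open>Counting\<close>

text \<open>Double counting of the pairs \<open>X \<subseteq> T\<close>.\<close>

lemma sum_card_containing:
  assumes R: "finite R" and F: "F \<subseteq> Pow R" "\<And>T. T \<in> F \<Longrightarrow> card T = m"
  shows "(\<Sum>X | X \<subseteq> R \<and> card X = k. card {T \<in> F. X \<subseteq> T}) = (m choose k) * card F"
proof (rule sum_multicount)
  show "finite {X. X \<subseteq> R \<and> card X = k}" using R by (auto intro: finite_subset[of _ "Pow R"])
  show "finite F" using R F by (auto intro: finite_subset[of _ "Pow R"])
  show "\<forall>T\<in>F. card {X \<in> {X. X \<subseteq> R \<and> card X = k}. X \<subseteq> T} = m choose k"
  proof
    fix T assume T: "T \<in> F"
    then have "{X \<in> {X. X \<subseteq> R \<and> card X = k}. X \<subseteq> T} = {X. X \<subseteq> T \<and> card X = k}" using F by auto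
    moreover have "finite T" using T F R finite_subset by blast
    ultimately show "card {X \<in> {X. X \<subseteq> R \<and> card X = k}. X \<subseteq> T} = m choose k"
      using n_subsets[of T k] F(2)[OF T] by simp
  qed
qed

text \<open>The bound \<open>(r / k) ^ k\<close>, with a positive \<open>c \<ge> k\<close> as
  denominator so that the case \<open>k = 0\<close>, which is dimension 2, is included.\<close>

lemma power_le_binomial:
  fixes r :: nat and x c :: real
  assumes "k \<le> r" "0 \<le> x" "0 < c" "k \<le> c" "x \<le> r"
  shows "(x / c) ^ k \<le> r choose k"
proof (cases "k = 0")
  case False
  have "x / c \<le> real r / real k" using assms False by (intro frac_le) auto
  then have "(x / c) ^ k \<le> (real r / real k) ^ k" using assms by (intro power_mono) auto
  also have "\<dots> \<le> r choose k" by (rule binomial_ge_n_over_k_pow_k[OF assms(1)])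
  finally show ?thesis .
qed simp

text \<open>Sum the bound over all sets \<open>X\<close> of \<open>d - 2\<close> red points, where
  \<open>d = CARD('n)\<close>, and divide by the number of such sets in one simplex. Balance makes
  at least a third of the points red.\<close>

lemma many_empty_red_simplices:
  fixes S R B :: "(real ^ 'n) set"
  assumes d: "2 \<le> CARD('n)"
    and S: "finite S" "general_position S" "S = R \<union> B" "R \<inter> B = {}"
    and n: "1000 + 3 * CARD('n) \<le> card S"
    and balanced: "\<And>C. \<lbrakk>convex C; card S / 16 \<le> card (S \<inter> C)\<rbrakk>
      \<Longrightarrow> discrepancy (C \<inter> R) (C \<inter> B) < root 3 (card S) / 10"
  shows "card S powr (real CARD('n) - 2 / 3)
      / (1920 * (3 * CARD('n)) ^ (CARD('n) - 2) * (CARD('n) + 1 choose (CARD('n) - 2)))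
    \<le> card (empty_red_simplices S R)"
proof -
  define d n where "d = CARD('n)" and "n = real (card S)"
  \<comment> \<open>The factor 10 gives \<open>\<delta> ^ 3 = n / 1000\<close>, so
    \<open>864 * \<delta> ^ 3 \<le> n\<close>, while \<open>n \<ge> 1000\<close> gives
    \<open>\<delta> \<ge> 1\<close>. It also turns 192 into 1920.\<close>
  define \<delta> where "\<delta> = root 3 n / 10"
  have n0: "1000 \<le> n" using assms(6) by (simp add: n_def)
  have cube: "root 3 n ^ 3 = n" using n0 by simp
  have "root 3 1000 \<le> root 3 n" using n0 by (rule real_root_le_mono[rotated]) simp
  moreover have "root 3 1000 = (10::real)" by (rule real_root_pos_unique) auto
  ultimately have \<delta>: "1 \<le> \<delta>" by (simp add: \<delta>_def)
  have \<delta>3: "\<delta> ^ 3 = n / 1000" using cube by (simp add: \<delta>_def power_divide)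
  have "\<delta> \<le> \<delta> ^ 3" using \<delta> by (auto intro: self_le_power)
  then have \<delta>n: "\<delta> \<le> n / 1000" using \<delta>3 by simp
  have "discrepancy (UNIV \<inter> R) (UNIV \<inter> B) < \<delta>"
    unfolding \<delta>_def n_def by (rule balanced) auto
  moreover have "n = real (card R) + card B" using S by (simp add: n_def card_Un_disjoint)
  ultimately have R: "n / 3 \<le> card R" using \<delta>n n0 by (simp add: discrepancy_def)
  have fR: "finite R" using S by simp
  let ?F = "empty_red_vertex_sets S R"
  have "(\<Sum>X | X \<subseteq> R \<and> card X = d - 2. n * \<delta> / 192) \<le> (\<Sum>X | X \<subseteq> R \<and> card X = d - 2. real (card {T \<in> ?F. X \<subseteq> T}))"
  proof (rule sum_mono)
    fix X assume "X \<in> {X. X \<subseteq> R \<and> card X = d - 2}"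
    then show "n * \<delta> / 192 \<le> real (card {T \<in> ?F. X \<subseteq> T})"
      unfolding n_def
      by (intro many_empty_simplices_containing[where B=B])
        (use S assms(1,6) balanced \<delta> \<delta>3 n0 in \<open>auto simp: d_def n_def \<delta>_def\<close>)
  qed
  also have "(\<Sum>X | X \<subseteq> R \<and> card X = d - 2. real (card {T \<in> ?F. X \<subseteq> T})) = real ((d + 1 choose (d - 2)) * card ?F)"
    unfolding of_nat_sum[symmetric]
    by (subst sum_card_containing[OF fR, where m = "d + 1"])
      (auto simp: empty_red_vertex_sets_def spans_empty_simplex_def d_def)
  finally have 1: "(card R choose (d - 2)) * (n * \<delta> / 192) \<le> (d + 1 choose (d - 2)) * card ?F"
    using n_subsets[OF fR] by simp
  have "(n / 3 / d) ^ (d - 2) \<le> card R choose (d - 2)"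
  proof (rule power_le_binomial)
    have "real (3 * d) \<le> n" using assms(6) by (simp add: n_def d_def)
    then show "d - 2 \<le> card R" using R by linarith
  qed (use R n0 assms(1) in \<open>auto simp: d_def\<close>)
  then have "(n / 3 / d) ^ (d - 2) * (n * \<delta> / 192) \<le> (card R choose (d - 2)) * (n * \<delta> / 192)"
    using n0 \<delta> by (intro mult_right_mono) auto
  with 1 have 2: "(n / 3 / d) ^ (d - 2) * (n * \<delta> / 192) \<le> (d + 1 choose (d - 2)) * card ?F" by linarith
  \<comment> \<open>The three summands of the exponent come from the choice of \<open>X\<close>, the
    factor \<open>n\<close> of the planar bound, and \<delta>.\<close>
  have "n powr (real d - 2 / 3) = n powr (real (d - 2) + 1 + 1 / 3)"
    using assms(1) by (simp add: d_def of_nat_diff)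
  also have "\<dots> = n powr real (d - 2) * n powr 1 * n powr (1 / 3)" by (simp only: powr_add)
  also have "\<dots> = n ^ (d - 2) * n * root 3 n"
    using n0 by (simp add: powr_realpow root_powr_inverse)
  finally have 3: "n powr (real d - 2 / 3) = n ^ (d - 2) * n * root 3 n" .
  have "n ^ (d - 2) * n * root 3 n / (1920 * (3 * d) ^ (d - 2)) = (n / 3 / d) ^ (d - 2) * (n * \<delta> / 192)"
    by (simp add: \<delta>_def power_divide power_mult_distrib)
  also note 2
  finally have "n powr (real d - 2 / 3) / (1920 * (3 * d) ^ (d - 2)) \<le> (d + 1 choose (d - 2)) * card ?F"
    unfolding 3 .
  moreover have "0 < (d + 1 choose (d - 2))" by simp
  ultimately have "n powr (real d - 2 / 3) / (1920 * (3 * d) ^ (d - 2)) / (d + 1 choose (d - 2)) \<le> card ?F"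
    by (simp only: pos_divide_le_eq of_nat_0_less_iff of_nat_mult mult.commute)
  then show ?thesis unfolding card_empty_red_simplices by (simp add: n_def d_def)
qed

theorem theorem32:
  assumes "CARD('n::finite) \<ge> 2"
  shows "\<exists>a1 a2 a3 :: real. a1 > 0 \<and> a2 > 0 \<and> a3 > 0 \<and>
    (\<forall>S R B :: (real ^ 'n) set.
       finite S \<and> general_position S \<and> S = R \<union> B \<and> R \<inter> B = {} \<longrightarrow>
       real (card (empty_red_simplices S R)) \<ge> a1 * real (card S) powr (real CARD('n) - 2 / 3) \<or>
       (\<exists>C. convex C \<and>
            real (card (S \<inter> C)) \<ge> a2 * real (card S) \<and>
            discrepancy (C \<inter> R) (C \<inter> B) \<ge> a3 * root 3 (real (card S))))"
proof -
  define N :: nat where "N = 1000 + 3 * CARD('n)"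
  define K :: real where "K = 1920 * (3 * CARD('n)) ^ (CARD('n) - 2) * (CARD('n) + 1 choose (CARD('n) - 2))"
  have "K > 0" by (simp add: K_def)
  have N: "N \<ge> 1000" by (simp add: N_def)
  have main: "1 / K * real (card S) powr (real CARD('n) - 2 / 3) \<le> card (empty_red_simplices S R) \<or>
       (\<exists>C. convex C \<and> 1 / N * card S \<le> card (S \<inter> C) \<and>
            1 / N * root 3 (card S) \<le> discrepancy (C \<inter> R) (C \<inter> B))"
    if S: "finite S" "general_position S" "S = R \<union> B" "R \<inter> B = {}" for S R B :: "(real ^ 'n) set"
  proof (cases "N \<le> card S")
    case True
    show ?thesis
    proof (cases "\<exists>C. convex C \<and> card S / 16 \<le> card (S \<inter> C) \<and> root 3 (card S) / 10 \<le> discrepancy (C \<inter> R) (C \<inter> B)")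
      case True
      then obtain C where C: "convex C" "card S / 16 \<le> card (S \<inter> C)" "root 3 (card S) / 10 \<le> discrepancy (C \<inter> R) (C \<inter> B)"
        by blast
      have "1 / N * card S \<le> card S / 16" "1 / N * root 3 (card S) \<le> root 3 (card S) / 10"
        using frac_le[of "real (card S)" "card S" 16 N] frac_le[of "root 3 (card S)" "root 3 (card S)" 10 N] N
        by simp_all
      then show ?thesis using C order_trans by blast
    next
      case False
      then have "card S powr (real CARD('n) - 2 / 3) / K \<le> card (empty_red_simplices S R)"
        unfolding K_def using \<open>N \<le> card S\<close> S assms
        by (intro many_empty_red_simplices) (auto simp: N_def not_le)
      then show ?thesis by simp
    qed
  next
    case False
    \<comment> \<open>Below the threshold \<open>N\<close> a single point \<open>{v}\<close> is a
      convex set of discrepancy 1, and the factor \<open>1 / N\<close> makes both bounds at most 1.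
      For empty \<open>S\<close> the required number of simplices is 0.\<close>
    show ?thesis
    proof (cases "S = {}")
      case False
      then obtain v where v: "v \<in> S" by blast
      have c: "1 \<le> card S" using v S(1) by (auto simp: Suc_le_eq card_gt_0_iff)
      then have "root 3 (card S) \<le> root 3 (card S ^ 3)"
        by (intro real_root_le_mono) (auto intro: self_le_power simp flip: of_nat_power)
      also have "\<dots> = card S" by (simp add: real_root_power_cancel)
      finally have "root 3 (card S) \<le> N" using \<open>\<not> N \<le> card S\<close> by linarith
      moreover have "v \<in> R \<and> v \<notin> B \<or> v \<notin> R \<and> v \<in> B" using v S by blast
      then have "discrepancy ({v} \<inter> R) ({v} \<inter> B) = 1" by (auto simp: discrepancy_def)
      moreover have "S \<inter> {v} = {v}" using v by blast
      ultimately show ?thesis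
        using \<open>\<not> N \<le> card S\<close> N by (intro disjI2 exI[of _ "{v}"]) auto
    qed simp
  qed
  show ?thesis
    by (rule exI[of _ "1 / K"], rule exI[of _ "1 / N"], rule exI[of _ "1 / N"])
      (use main \<open>K > 0\<close> N in auto)
qed

end
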